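(* Consider the forward complete system $\dot x=f(x,d)$ with output $y=h(x)$ described in the context. Suppose that there exist continuously differentiable functions $V,W:\mathbb{R}^n\to\mathbb{R}_{\ge 0}$ and a continuous positive definite function $\rho:\mathbb{R}_{\ge 0}\to\mathbb{R}_{\ge 0}$ such that, for all $x\in\mathbb{R}^n$ and all $d\in D$, $$\nabla V(x)f(x,d)\le -\rho(W(x)).$$ Assume further that, for some constant $r>0$ and some function $a\in\mathcal{K}$, it holds for all $x\in\mathbb{R}^n$ with $W(x)<r$ and all $d\in D$ that $$a(|h(x)|)\le W(x),\qquad \nabla W(x)f(x,d)\le 0.$$ Suppose that at least one of the following two conditions holds: (i) $\liminf_{s\to+\infty}\rho(s)>0$; (ii) there exist $\zeta\in\mathcal{K}_\infty$ and a continuously differentiable function $Q:\mathbb{R}^n\to\mathbb{R}_{\ge 0}$ such that, for all $x\in\mathbb{R}^n$ and all $d\in D$, $W(x)\le\zeta(Q(x))$ and $\nabla Q(x)f(x,d)\le 0$. Then the system is URGOA and robustly Lyapunov output stable. In particular, if in addition $D$ is compact and $f$ is locally Lipschitz in the sense that for every compact set $S\subseteq\mathbb{R}^n$ there exists $L_S>0$ such that $|f(x,d)-f(z,e)|\le L_S(|x-z|+|d-e|)$ for all $x,z\in S$ and all $d,e\in D$, then the system is URGAOS.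
   Context: Setting. $D\subseteq\mathbb{R}^m$ is a non-empty set, and $f:\mathbb{R}^n\times D\to\mathbb{R}^n$ is continuous and locally Lipschitz in its first variable, uniformly in the second on bounded subsets of $D$: for every compact $S\subseteq\mathbb{R}^n$ and every bounded $K\subseteq D$ there is $L_{S,K}>0$ such that $|f(x,d)-f(z,d)|\le L_{S,K}|x-z|$ for all $x,z\in S$, $d\in K$. Moreover $f(0,d)=0$ for all $d\in D$. The output map $h:\mathbb{R}^n\to\mathbb{R}^k$ is continuous with $h(0)=0$. Consider $\dot x=f(x,d)$, $y=h(x)$, with inputs $d\in L^\infty_{loc}(\mathbb{R}_{\ge 0};D)$ (measurable, locally essentially bounded functions $\mathbb{R}_{\ge0}\to D$). The system is assumed forward complete: for every $x_0\in\mathbb{R}^n$ and every such $d$ the unique solution $\phi(t,x_0;d)$ with $\phi(0,x_0;d)=x_0$ exists for all $t\ge 0$. Write $y(t,x_0;d):=h(\phi(t,x_0;d))$. Notation. $|\cdot|$ is the Euclidean norm. $\mathcal{K}$ is the set of continuous (strictly) increasing $\alpha:\mathbb{R}_{\ge0}\to\mathbb{R}_{\ge0}$ with $\alpha(0)=0$; $\mathcal{K}_\infty$ is the set of $\alpha\in\mathcal{K}$ with $\lim_{s\to+\infty}\alpha(s)=+\infty$. A function $\rho:\mathbb{R}_{\ge0}\to\mathbb{R}_{\ge0}$ is positive definite if $\rho(0)=0$ and $\rho(s)>0$ for $s>0$. Definitions. The system is: - URGOA (uniformly robustly globally output attractive) if for every $\varepsilon,R>0$ there is $T(\varepsilon,R)>0$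 such that for all $d\in L^\infty_{loc}(\mathbb{R}_{\ge0};D)$ and all $x_0$ with $|x_0|\le R$, $|y(t,x_0;d)|\le\varepsilon$ for all $t\ge T(\varepsilon,R)$. - robustly Lyapunov output stable if for every $\varepsilon>0$ there is $\delta(\varepsilon)>0$ such that for all $d\in L^\infty_{loc}(\mathbb{R}_{\ge0};D)$ and all $x_0$ with $|x_0|\le\delta(\varepsilon)$, $|y(t,x_0;d)|\le\varepsilon$ for all $t\ge0$. - robustly Lagrange output stable if for every $\delta>0$ there is $\varepsilon(\delta)>0$ such that for all $d\in L^\infty_{loc}(\mathbb{R}_{\ge0};D)$ and all $x_0$ with $|x_0|\le\delta$, $|y(t,x_0;d)|\le\varepsilon(\delta)$ for all $t\ge0$. - URGAOS (uniformly robustly globally asymptotically output stable) if it is robustly Lagrange output stable, robustly Lyapunov output stable and URGOA. *)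

theory Defs
  imports "HOL-Analysis.Analysis"
begin

definition class_K :: "(real \<Rightarrow> real) set" where
  "class_K = {\<alpha>. continuous_on {0..} \<alpha> \<and> strict_mono_on {0..} \<alpha> \<and> \<alpha> 0 = 0}"

definition class_K_inf :: "(real \<Rightarrow> real) set" where
  "class_K_inf = {\<alpha> \<in> class_K. filterlim \<alpha> at_top at_top}"

definition pos_def :: "(real \<Rightarrow> real) \<Rightarrow> bool" where
  "pos_def \<rho> \<longleftrightarrow> \<rho> 0 = 0 \<and> (\<forall>s>0. \<rho> s > 0)"

text \<open>\<open>C1_with_gradient V gV\<close>: \<open>V\<close> is continuously differentiable on the whole space
  and \<open>gV\<close> is its gradient.\<close>

definition C1_with_gradient ::
  "('a::euclidean_space \<Rightarrow> real) \<Rightarrow> ('a \<Rightarrow> 'a) \<Rightarrow> bool" where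
  "C1_with_gradient V gV \<longleftrightarrow> (\<forall>x. GDERIV V x :> gV x) \<and> continuous_on UNIV gV"

text \<open>The locally essentially bounded, Lebesgue measurable inputs with values in \<open>D\<close>. Only the
  values at times \<open>t \<ge> 0\<close> matter, here and for solutions below.\<close>

definition inputs :: "'b::euclidean_space set \<Rightarrow> (real \<Rightarrow> 'b) set" where
  "inputs D = {d. d \<in> borel_measurable (lebesgue_on {0..}) \<and> (\<forall>t\<ge>0. d t \<in> D) \<and>
     (\<forall>T\<ge>0. \<exists>C. AE t in lebesgue_on {0..T}. norm (d t) \<le> C)}"

text \<open>Caratheodory solutions on \<open>[0, \<infinity>)\<close> in integral form: \<open>\<phi>\<close> is locally absolutely continuous,
  starts in \<open>x0\<close> and satisfies \<open>\<phi>' t = f (\<phi> t) (d t)\<close> for almost every \<open>t \<ge> 0\<close>.\<close>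

definition solution ::
  "('a::euclidean_space \<Rightarrow> 'b \<Rightarrow> 'a) \<Rightarrow> 'a \<Rightarrow> (real \<Rightarrow> 'b) \<Rightarrow> (real \<Rightarrow> 'a) \<Rightarrow> bool" where
  "solution f x0 d \<phi> \<longleftrightarrow>
     (\<forall>t\<ge>0. (\<lambda>s. f (\<phi> s) (d s)) absolutely_integrable_on {0..t} \<and>
            \<phi> t = x0 + integral {0..t} (\<lambda>s. f (\<phi> s) (d s)))"

text \<open>Under the Lipschitz hypothesis on \<open>f\<close> any two solutions with the same data agree on
  \<open>[0, \<infinity>)\<close>; so existence of a global solution is the whole content of forward completeness, and
  in the stability notions the quantifier over all solutions \<open>\<phi>\<close> ranges over just one trajectory.\<close>

definition forward_complete ::
  "'b::euclidean_space set \<Rightarrow> ('a::euclidean_space \<Rightarrow> 'b \<Rightarrow> 'a) \<Rightarrow> bool" where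
  "forward_complete D f \<longleftrightarrow> (\<forall>x0. \<forall>d\<in>inputs D. \<exists>\<phi>. solution f x0 d \<phi>)"

definition URGOA ::
  "'b::euclidean_space set \<Rightarrow> ('a::euclidean_space \<Rightarrow> 'b \<Rightarrow> 'a) \<Rightarrow>
   ('a \<Rightarrow> 'c::euclidean_space) \<Rightarrow> bool" where
  "URGOA D f h \<longleftrightarrow>
     (\<forall>\<epsilon>>0. \<forall>R>0. \<exists>T>0. \<forall>d\<in>inputs D. \<forall>x0 \<phi>.
        norm x0 \<le> R \<and> solution f x0 d \<phi> \<longrightarrow> (\<forall>t\<ge>T. norm (h (\<phi> t)) \<le> \<epsilon>))"

definition robustly_Lyapunov_output_stable ::
  "'b::euclidean_space set \<Rightarrow> ('a::euclidean_space \<Rightarrow> 'b \<Rightarrow> 'a) \<Rightarrow>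
   ('a \<Rightarrow> 'c::euclidean_space) \<Rightarrow> bool" where
  "robustly_Lyapunov_output_stable D f h \<longleftrightarrow>
     (\<forall>\<epsilon>>0. \<exists>\<delta>>0. \<forall>d\<in>inputs D. \<forall>x0 \<phi>.
        norm x0 \<le> \<delta> \<and> solution f x0 d \<phi> \<longrightarrow> (\<forall>t\<ge>0. norm (h (\<phi> t)) \<le> \<epsilon>))"

definition robustly_Lagrange_output_stable ::
  "'b::euclidean_space set \<Rightarrow> ('a::euclidean_space \<Rightarrow> 'b \<Rightarrow> 'a) \<Rightarrow>
   ('a \<Rightarrow> 'c::euclidean_space) \<Rightarrow> bool" where
  "robustly_Lagrange_output_stable D f h \<longleftrightarrow>
     (\<forall>\<delta>>0. \<exists>\<epsilon>>0. \<forall>d\<in>inputs D. \<forall>x0 \<phi>.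
        norm x0 \<le> \<delta> \<and> solution f x0 d \<phi> \<longrightarrow> (\<forall>t\<ge>0. norm (h (\<phi> t)) \<le> \<epsilon>))"

definition URGAOS ::
  "'b::euclidean_space set \<Rightarrow> ('a::euclidean_space \<Rightarrow> 'b \<Rightarrow> 'a) \<Rightarrow>
   ('a \<Rightarrow> 'c::euclidean_space) \<Rightarrow> bool" where
  "URGAOS D f h \<longleftrightarrow> robustly_Lagrange_output_stable D f h \<and>
     robustly_Lyapunov_output_stable D f h \<and> URGOA D f h"

end

theory Submission
  imports Defs
begin

text \<open>
  Along solutions \<open>V\<close> decreases at rate \<open>\<rho> (W x)\<close>, and each sublevel set of \<open>W\<close> below \<open>r\<close> is forward
  invariant. Either alternative bounds \<open>\<rho> (W x)\<close> from below by a positive constant as long as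
  \<open>W x \<ge> \<eta>\<close>, uniformly in the initial values from a ball; since \<open>V \<ge> 0\<close>, the sublevel set
  \<open>W \<le> \<eta>\<close> is then reached within a uniform time. Lyapunov stability uses \<open>W 0 = 0\<close>, which
  follows from \<open>f 0 d = 0\<close>.

  For Lagrange stability, output attractivity leaves only a bounded time interval, so it suffices that
  a forward complete system with bounded input set has bounded reachable sets in finite time.
  Otherwise some point is bad: arbitrarily close to it, trajectories get arbitrarily far within
  (almost) a fixed time \<open>T\<close>. Stopping such trajectories on a large sphere gives another bad point for
  the remaining time. As flows are open maps (invariance of domain), with a uniform estimate from
  Gronwall's inequality, every neighbourhood of a bad point contains a point steered exactly to the
  new bad point. Iterating produces nested balls of initial values and consistent inputs; a common
  point of the balls has a trajectory that is unbounded in finite time.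
\<close>

subsection \<open>Decay along solutions\<close>

text \<open>Finitely many steps of length \<open>\<delta>/2\<close> lead from \<open>t\<close> back
  to \<open>s\<close>; halving respects the strict bound \<open>b - a < \<delta>\<close>. This
  globalises estimates valid only over short times.\<close>

lemma locally_nonincreasing_imp_le:
  fixes F :: "real \<Rightarrow> real"
  assumes "\<delta> > 0" "s \<le> t"
    and step: "\<And>a b. s \<le> a \<Longrightarrow> a \<le> b \<Longrightarrow> b \<le> t \<Longrightarrow> b - a < \<delta> \<Longrightarrow> F b \<le> F a"
  shows "F t \<le> F s"
proof -
  have main: "F x \<le> F s" if "s \<le> x" "x \<le> t" "x - s \<le> real n * (\<delta>/2)" for x n
    using that
  proof (induction n arbitrary: x)
    case 0
    then show ?case by simp
  next
    case (Suc n)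
    \<comment> \<open>Clipping at \<open>s\<close> keeps the last, possibly shorter, step inside the
      interval.\<close>
    define y where "y = max s (x - \<delta>/2)"
    have "F y \<le> F s"
      by (rule Suc.IH) (use Suc.prems \<open>\<delta> > 0\<close> in \<open>auto simp: y_def max_def algebra_simps\<close>)
    moreover have "F x \<le> F y"
      by (rule step) (use Suc.prems \<open>\<delta> > 0\<close> in \<open>auto simp: y_def max_def\<close>)
    ultimately show ?case by simp
  qed
  obtain n where "(t - s) / (\<delta>/2) \<le> real n"
    using real_arch_simple by blast
  then have "t - s \<le> real n * (\<delta>/2)"
    using \<open>\<delta> > 0\<close> by (simp add: field_simps)
  then show ?thesis
    using main \<open>s \<le> t\<close> by blast
qed

text \<open>The time is the least element of the closed set where \<open>g \<ge> c\<close>. It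
  serves continuation arguments, where a bound valid before \<open>\<tau>\<close> is played against
  the value at \<open>\<tau>\<close>, and the stopping of trajectories on a sphere.\<close>

lemma first_hitting_time:
  fixes g :: "real \<Rightarrow> real"
  assumes cont: "continuous_on {s..t} g" and "s \<le> t" "g s < c" "g t \<ge> c"
  obtains \<tau> where "s < \<tau>" "\<tau> \<le> t" "g \<tau> = c" "\<And>\<sigma>. s \<le> \<sigma> \<Longrightarrow> \<sigma> < \<tau> \<Longrightarrow> g \<sigma> < c"
proof -
  define S where "S = {\<sigma> \<in> {s..t}. c \<le> g \<sigma>}"
  have "closed S"
    using continuous_closed_preimage[OF cont, of "{c..}"]
    by (simp add: S_def vimage_def Int_def conj_commute)
  have ne: "S \<noteq> {}" using assms by (auto simp: S_def)
  have bdd: "bdd_below S" unfolding S_def by (rule bdd_belowI[of _ s]) auto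
  define \<tau> where "\<tau> = Inf S"
  have \<tau>S: "\<tau> \<in> S"
    unfolding \<tau>_def using closed_contains_Inf[OF ne bdd \<open>closed S\<close>] .
  have low: "\<sigma> \<in> S \<Longrightarrow> \<tau> \<le> \<sigma>" for \<sigma>
    unfolding \<tau>_def using bdd by (rule cInf_lower[rotated])
  have *: "s \<le> \<tau>" "\<tau> \<le> t" "c \<le> g \<tau>" using \<tau>S by (auto simp: S_def)
  \<comment> \<open>The value \<open>c\<close> is taken no later than \<open>\<tau>\<close>, and
    minimality of \<open>\<tau>\<close> excludes any earlier time.\<close>
  have "\<exists>x\<ge>s. x \<le> \<tau> \<and> g x = c"
    by (rule IVT') (use * assms in \<open>auto intro: continuous_on_subset[OF cont]\<close>)
  then obtain x where x: "s \<le> x" "x \<le> \<tau>" "g x = c" by blast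
  then have "x \<in> S" using * by (auto simp: S_def)
  then have "x = \<tau>" using low x by force
  show ?thesis
  proof (rule that[of \<tau>])
    show "s < \<tau>" using * \<open>g s < c\<close> by (metis leD le_less)
    show "g \<sigma> < c" if "s \<le> \<sigma>" "\<sigma> < \<tau>" for \<sigma>
      using low[of \<sigma>] that * by (force simp: S_def not_le[symmetric])
  qed (use * x \<open>x = \<tau>\<close> in auto)
qed

text \<open>The one-dimensional mean value theorem along the segment. Since balls are convex,
  \<open>z\<close> is close to every point to which both ends are close.\<close>

lemma C1_mean_value:
  fixes V :: "'a::euclidean_space \<Rightarrow> real"
  assumes "C1_with_gradient V gV"
  obtains z where "z \<in> closed_segment x y" "V y - V x = (y - x) \<bullet> gV z"
proof -
  have der: "((\<lambda>u. V (x + u *\<^sub>R (y - x))) has_derivative (\<lambda>v. (v *\<^sub>R (y - x)) \<bullet> gV (x + u *\<^sub>R (y - x))))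
      (at u within {0..1})" for u :: real
  proof -
    have "(V has_derivative (\<lambda>h. h \<bullet> gV (x + u *\<^sub>R (y - x)))) (at (x + u *\<^sub>R (y - x)))"
      using assms by (simp add: C1_with_gradient_def gderiv_def)
    moreover have "((\<lambda>u. x + u *\<^sub>R (y - x)) has_derivative (\<lambda>v. v *\<^sub>R (y - x))) (at u within {0..1})"
      by (auto intro!: derivative_eq_intros)
    ultimately show ?thesis
      using has_derivative_compose by blast
  qed
  obtain u where u: "u \<in> {0<..<1::real}"
    "V (x + 1 *\<^sub>R (y - x)) - V (x + 0 *\<^sub>R (y - x)) = ((1 - 0) *\<^sub>R (y - x)) \<bullet> gV (x + u *\<^sub>R (y - x))"
    using mvt_simple[of 0 1 "\<lambda>u. V (x + u *\<^sub>R (y - x))", OF _ der] by auto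
  have "x + u *\<^sub>R (y - x) \<in> closed_segment x y"
    using u(1) unfolding in_segment by (intro exI[of _ u]) (auto simp: algebra_simps)
  then show ?thesis using that u(2) by simp
qed

lemma C1_continuous_on:
  assumes "C1_with_gradient V gV"
  shows "continuous_on S V"
proof (rule continuous_at_imp_continuous_on, rule ballI)
  show "isCont V x" for x
    using assms by (auto simp: C1_with_gradient_def gderiv_def intro: has_derivative_continuous)
qed

text \<open>In place of a chain rule for absolutely continuous curves, the mean
  value theorem shows that \<open>V \<circ> \<phi>\<close> decays at rate \<open>c\<close> up to \<open>\<epsilon> \<integral> \<bar>g\<bar>\<close> over short time steps.\<close>

lemma decay_along_curve:
  fixes V :: "'a::euclidean_space \<Rightarrow> real"
  assumes V: "C1_with_gradient V gV" and "s \<le> t"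
    and g: "g absolutely_integrable_on {s..t}"
    and cont: "continuous_on {s..t} \<phi>"
    and \<phi>: "\<And>a b. s \<le> a \<Longrightarrow> a \<le> b \<Longrightarrow> b \<le> t \<Longrightarrow> \<phi> b = \<phi> a + integral {a..b} g"
    and decay: "\<And>\<sigma>. s \<le> \<sigma> \<Longrightarrow> \<sigma> \<le> t \<Longrightarrow> gV (\<phi> \<sigma>) \<bullet> g \<sigma> \<le> - c"
  shows "V (\<phi> t) \<le> V (\<phi> s) - c * (t - s)"
proof -
  have gi: "g integrable_on {a..b}" and ni: "(\<lambda>x. norm (g x)) integrable_on {a..b}"
    if "s \<le> a" "b \<le> t" for a b
    using g that unfolding absolutely_integrable_on_def
    by (auto intro: integrable_on_subinterval)
  define N where "N = integral {s..t} (\<lambda>x. norm (g x))"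
  have "N \<ge> 0" unfolding N_def by (rule integral_nonneg) (use ni in auto)
  obtain B where B: "\<forall>\<sigma>\<in>{s..t}. norm (\<phi> \<sigma>) \<le> B"
    using compact_imp_bounded[OF compact_continuous_image[OF cont compact_Icc]]
    by (auto simp: bounded_iff)
  have eps: "V (\<phi> t) + c * t \<le> V (\<phi> s) + c * s + \<epsilon> * N" if "\<epsilon> > 0" for \<epsilon>
  proof -
    have "uniformly_continuous_on (cball 0 B) gV"
      using V compact_uniformly_continuous[of "cball 0 B" gV]
      by (auto simp: C1_with_gradient_def intro: continuous_on_subset)
    then obtain \<delta>1 where \<delta>1: "\<delta>1 > 0"
      "\<And>x y. x \<in> cball 0 B \<Longrightarrow> y \<in> cball 0 B \<Longrightarrow> dist x y < \<delta>1 \<Longrightarrow> dist (gV x) (gV y) < \<epsilon>"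
      unfolding uniformly_continuous_on_def using \<open>\<epsilon> > 0\<close> by metis
    have "uniformly_continuous_on {s..t} \<phi>"
      using cont by (simp add: compact_uniformly_continuous)
    then obtain \<delta>2 where \<delta>2: "\<delta>2 > 0"
      "\<And>x y. x \<in> {s..t} \<Longrightarrow> y \<in> {s..t} \<Longrightarrow> dist x y < \<delta>2 \<Longrightarrow> dist (\<phi> x) (\<phi> y) < \<delta>1"
      unfolding uniformly_continuous_on_def using \<open>\<delta>1 > 0\<close> by metis
    \<comment> \<open>The total error \<open>\<epsilon> * N\<close> is spread in proportion to the
      integral of \<open>norm (g x)\<close>, so that the estimates over short steps
      telescope.\<close>
    define F where "F \<tau> = V (\<phi> \<tau>) + c * \<tau> - \<epsilon> * integral {s..\<tau>} (\<lambda>x. norm (g x))" for \<tau>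
    have "F t \<le> F s"
    proof (rule locally_nonincreasing_imp_le[OF \<open>\<delta>2 > 0\<close> \<open>s \<le> t\<close>])
      fix a b assume ab: "s \<le> a" "a \<le> b" "b \<le> t" "b - a < \<delta>2"
      obtain z where z: "z \<in> closed_segment (\<phi> a) (\<phi> b)" "V (\<phi> b) - V (\<phi> a) = (\<phi> b - \<phi> a) \<bullet> gV z"
        using C1_mean_value[OF V] by blast
      have zB: "z \<in> cball 0 B"
        using z(1) closed_segment_subset[of "\<phi> a" "cball 0 B" "\<phi> b"] B ab by auto
      have near: "dist (gV z) (gV (\<phi> \<sigma>)) < \<epsilon>" if "\<sigma> \<in> {a..b}" for \<sigma>
      proof (rule \<delta>1(2)[OF zB])
        show "\<phi> \<sigma> \<in> cball 0 B" using B ab that by auto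
        have "\<phi> a \<in> ball (\<phi> \<sigma>) \<delta>1" "\<phi> b \<in> ball (\<phi> \<sigma>) \<delta>1"
          using \<delta>2(2) ab that by (auto simp: dist_real_def)
        then have "z \<in> ball (\<phi> \<sigma>) \<delta>1"
          using z(1) closed_segment_subset[OF _ _ convex_ball] by blast
        then show "dist z (\<phi> \<sigma>) < \<delta>1" by (simp add: dist_commute)
      qed
      have "(\<phi> b - \<phi> a) \<bullet> gV z = integral {a..b} g \<bullet> gV z"
        using \<phi>[of a b] ab by simp
      \<comment> \<open>As \<open>gV z\<close> is constant in \<open>\<sigma>\<close>, the product
        moves under the integral, where \<open>gV z\<close> is replaced by
        \<open>gV (\<phi> \<sigma>)\<close> at the price
        \<open>\<epsilon> * norm (g \<sigma>)\<close>.\<close>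
      also have "\<dots> = integral {a..b} (\<lambda>\<sigma>. g \<sigma> \<bullet> gV z)"
        using integral_linear[OF gi bounded_linear_inner_left, of a b "gV z"] ab by (simp add: o_def)
      also have "\<dots> \<le> integral {a..b} (\<lambda>\<sigma>. - c + \<epsilon> * norm (g \<sigma>))"
      proof (rule integral_le)
        show "(\<lambda>\<sigma>. g \<sigma> \<bullet> gV z) integrable_on {a..b}"
          using integrable_linear[OF gi bounded_linear_inner_left, of a b "gV z"] ab by (simp add: o_def)
        show "(\<lambda>\<sigma>. - c + \<epsilon> * norm (g \<sigma>)) integrable_on {a..b}"
          using ni[of a b] ab by (intro integrable_add integrable_on_mult_right) auto
        fix \<sigma> assume \<sigma>: "\<sigma> \<in> {a..b}"
        have "g \<sigma> \<bullet> gV z = gV (\<phi> \<sigma>) \<bullet> g \<sigma> + (gV z - gV (\<phi> \<sigma>)) \<bullet> g \<sigma>"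
          by (simp add: inner_diff_left inner_diff_right inner_commute)
        also have "\<dots> \<le> - c + \<epsilon> * norm (g \<sigma>)"
        proof (rule add_mono)
          show "gV (\<phi> \<sigma>) \<bullet> g \<sigma> \<le> - c" using decay \<sigma> ab by auto
          have "(gV z - gV (\<phi> \<sigma>)) \<bullet> g \<sigma> \<le> norm (gV z - gV (\<phi> \<sigma>)) * norm (g \<sigma>)"
            by (rule norm_cauchy_schwarz)
          also have "\<dots> \<le> \<epsilon> * norm (g \<sigma>)"
            using near[OF \<sigma>] by (intro mult_right_mono) (auto simp: dist_norm)
          finally show "(gV z - gV (\<phi> \<sigma>)) \<bullet> g \<sigma> \<le> \<epsilon> * norm (g \<sigma>)" .
        qed
        finally show "g \<sigma> \<bullet> gV z \<le> - c + \<epsilon> * norm (g \<sigma>)" .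
      qed
      also have "\<dots> = - c * (b - a) + \<epsilon> * integral {a..b} (\<lambda>\<sigma>. norm (g \<sigma>))"
        using ni[of a b] ab by (subst integral_add) (auto intro: integrable_on_mult_right)
      finally have "V (\<phi> b) - V (\<phi> a) \<le> - c * (b - a) + \<epsilon> * integral {a..b} (\<lambda>\<sigma>. norm (g \<sigma>))"
        using z(2) by simp
      moreover have "integral {s..a} (\<lambda>x. norm (g x)) + integral {a..b} (\<lambda>x. norm (g x)) = integral {s..b} (\<lambda>x. norm (g x))"
        by (rule Henstock_Kurzweil_Integration.integral_combine) (use ab ni in auto)
      ultimately show "F b \<le> F a"
        unfolding F_def by (smt (verit) distrib_left minus_mult_left right_diff_distrib)
    qed
    then show ?thesis by (simp add: F_def N_def)
  qed
  have "V (\<phi> t) + c * t \<le> V (\<phi> s) + c * s + e" if "e > 0" for e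
  proof -
    \<comment> \<open>Dividing by \<open>N + 1\<close> also covers \<open>N = 0\<close>.\<close>
    have "e / (N + 1) * N \<le> e" using \<open>N \<ge> 0\<close> that by (simp add: field_simps)
    with eps[of "e / (N + 1)"] \<open>N \<ge> 0\<close> that show ?thesis by simp
  qed
  then have "V (\<phi> t) + c * t \<le> V (\<phi> s) + c * s"
    by (rule field_le_epsilon)
  then show ?thesis by (simp add: algebra_simps)
qed

section \<open>Elementary properties of solutions in integral form\<close>

lemma solution_absolutely_integrable:
  assumes "solution f x0 d \<phi>" "0 \<le> a"
  shows "(\<lambda>s. f (\<phi> s) (d s)) absolutely_integrable_on {a..b}"
proof -
  have "(\<lambda>s. f (\<phi> s) (d s)) absolutely_integrable_on {0..max 0 b}"
    using assms(1) by (simp add: solution_def)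
  then show ?thesis
    by (rule absolutely_integrable_on_subinterval) (use assms(2) in auto)
qed

lemma solution_integrable:
  assumes "solution f x0 d \<phi>" "0 \<le> a"
  shows "(\<lambda>s. f (\<phi> s) (d s)) integrable_on {a..b}"
  using solution_absolutely_integrable[OF assms] absolutely_integrable_on_def by blast

lemma solution_increment:
  assumes "solution f x0 d \<phi>" "0 \<le> a" "a \<le> b"
  shows "\<phi> b = \<phi> a + integral {a..b} (\<lambda>s. f (\<phi> s) (d s))"
proof -
  have "\<phi> a = x0 + integral {0..a} (\<lambda>s. f (\<phi> s) (d s))" "\<phi> b = x0 + integral {0..b} (\<lambda>s. f (\<phi> s) (d s))"
    using assms by (auto simp: solution_def)
  moreover have "integral {0..a} (\<lambda>s. f (\<phi> s) (d s)) + integral {a..b} (\<lambda>s. f (\<phi> s) (d s))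
      = integral {0..b} (\<lambda>s. f (\<phi> s) (d s))"
    using assms by (intro Henstock_Kurzweil_Integration.integral_combine solution_integrable) auto
  ultimately show ?thesis by simp
qed

lemma solution_at_0: "solution f x0 d \<phi> \<Longrightarrow> \<phi> 0 = x0"
  by (force simp: solution_def)

lemma solution_continuous_on:
  assumes "solution f x0 d \<phi>" "0 \<le> a"
  shows "continuous_on {a..b} \<phi>"
proof -
  have "continuous_on {0..b} (\<lambda>t. x0 + integral {0..t} (\<lambda>s. f (\<phi> s) (d s)))"
    by (intro continuous_intros indefinite_integral_continuous_1 solution_integrable[OF assms(1)]) auto
  then have "continuous_on {a..b} (\<lambda>t. x0 + integral {0..t} (\<lambda>s. f (\<phi> s) (d s)))"
    by (rule continuous_on_subset) (use assms in auto)
  then show ?thesis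
    by (rule continuous_on_eq) (use assms in \<open>auto simp: solution_def\<close>)
qed

lemma decay_along_solution:
  assumes V: "C1_with_gradient V gV" and sol: "solution f x0 d \<phi>" and "0 \<le> s" "s \<le> t"
    and decay: "\<And>\<sigma>. s \<le> \<sigma> \<Longrightarrow> \<sigma> \<le> t \<Longrightarrow> gV (\<phi> \<sigma>) \<bullet> f (\<phi> \<sigma>) (d \<sigma>) \<le> - c"
  shows "V (\<phi> t) \<le> V (\<phi> s) - c * (t - s)"
proof (rule decay_along_curve[OF V \<open>s \<le> t\<close>])
  show "(\<lambda>s. f (\<phi> s) (d s)) absolutely_integrable_on {s..t}"
    by (rule solution_absolutely_integrable[OF sol \<open>0 \<le> s\<close>])
  show "continuous_on {s..t} \<phi>"
    by (rule solution_continuous_on[OF sol \<open>0 \<le> s\<close>])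
  show "\<phi> b = \<phi> a + integral {a..b} (\<lambda>s. f (\<phi> s) (d s))" if "s \<le> a" "a \<le> b" for a b
    by (rule solution_increment[OF sol]) (use \<open>0 \<le> s\<close> that in auto)
qed (rule decay)

text \<open>Decay of \<open>W\<close> is known only below \<open>r\<close>, so staying below
  \<open>r\<close> is bootstrapped: until a level between \<open>W (\<phi> s)\<close> and
  \<open>r\<close> is hit, \<open>W\<close> cannot rise above its starting value.\<close>

lemma nonincreasing_below_level:
  assumes W: "C1_with_gradient W gW" and sol: "solution f x0 d \<phi>" and "0 \<le> s" "s \<le> t"
    and d: "\<And>\<sigma>. 0 \<le> \<sigma> \<Longrightarrow> d \<sigma> \<in> D"
    and W_decay: "\<And>x d. W x < r \<Longrightarrow> d \<in> D \<Longrightarrow> gW x \<bullet> f x d \<le> 0"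
    and "W (\<phi> s) < r"
  shows "W (\<phi> t) \<le> W (\<phi> s)"
proof -
  have noninc: "W (\<phi> b) \<le> W (\<phi> s)" if "s \<le> b" "\<And>\<sigma>. s \<le> \<sigma> \<Longrightarrow> \<sigma> \<le> b \<Longrightarrow> W (\<phi> \<sigma>) < r" for b
  proof -
    have "W (\<phi> b) \<le> W (\<phi> s) - 0 * (b - s)"
      by (rule decay_along_solution[OF W sol]) (use that W_decay d \<open>0 \<le> s\<close> in auto)
    then show ?thesis by simp
  qed
  have cont: "continuous_on {s..b} (\<lambda>\<sigma>. W (\<phi> \<sigma>))" for b
    using continuous_on_compose[OF solution_continuous_on[OF sol \<open>0 \<le> s\<close>] C1_continuous_on[OF W]]
    by (simp add: o_def)
  \<comment> \<open>Strictly below \<open>r\<close>, so that decay still applies up to and including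
    the hitting time.\<close>
  define c where "c = (W (\<phi> s) + r) / 2"
  have c: "W (\<phi> s) < c" "c < r" using \<open>W (\<phi> s) < r\<close> by (auto simp: c_def)
  have "W (\<phi> \<sigma>) < r" if "s \<le> \<sigma>" "\<sigma> \<le> t" for \<sigma>
  proof (rule ccontr)
    assume "\<not> W (\<phi> \<sigma>) < r"
    then have "W (\<phi> \<sigma>) \<ge> c" using c by simp
    from first_hitting_time[OF cont \<open>s \<le> \<sigma>\<close> c(1) this]
    obtain \<tau> where \<tau>: "s < \<tau>" "W (\<phi> \<tau>) = c" "\<And>\<sigma>. s \<le> \<sigma> \<Longrightarrow> \<sigma> < \<tau> \<Longrightarrow> W (\<phi> \<sigma>) < c"
      by blast
    have "W (\<phi> \<tau>) \<le> W (\<phi> s)"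
    proof (rule noninc)
      show "W (\<phi> \<sigma>) < r" if "s \<le> \<sigma>" "\<sigma> \<le> \<tau>" for \<sigma>
        using \<tau>(2) \<tau>(3)[OF that(1)] that(2) c by (cases "\<sigma> = \<tau>") auto
    qed (use \<tau> in simp)
    then show False using \<tau> c by simp
  qed
  then show ?thesis using noninc[OF \<open>s \<le> t\<close>] by simp
qed

section \<open>Comparison functions and lower bounds on the decay rate\<close>

lemma class_K_le_imp_le:
  assumes "a \<in> class_K" "a x \<le> a y" "0 \<le> x" "0 \<le> y"
  shows "x \<le> y"
proof (rule ccontr)
  assume "\<not> x \<le> y"
  then show False
    using assms strict_mono_onD[of "{0..}" a y x] by (simp add: class_K_def)
qed

lemma class_K_pos:
  assumes "a \<in> class_K" "0 < x"
  shows "0 < a x"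
  using assms strict_mono_onD[of "{0..}" a 0 x] by (simp add: class_K_def)

lemma class_K_mono:
  assumes "a \<in> class_K" "0 \<le> x" "x \<le> y"
  shows "a x \<le> a y"
  using assms strict_mono_onD[of "{0..}" a x y] by (cases "x = y") (auto simp: class_K_def)

lemma inputs_in: "d \<in> inputs D \<Longrightarrow> 0 \<le> t \<Longrightarrow> d t \<in> D"
  by (simp add: inputs_def)

text \<open>The minimum over a compact interval that avoids \<open>0\<close> is attained and
  positive.\<close>

lemma pos_def_bounded_below_on_Icc:
  assumes "continuous_on {0..} \<rho>" "pos_def \<rho>" "0 < \<eta>"
  obtains c where "0 < c" "\<And>s. \<eta> \<le> s \<Longrightarrow> s \<le> X \<Longrightarrow> c \<le> \<rho> s"
proof (cases "\<eta> \<le> X")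
  case True
  have "continuous_on {\<eta>..X} \<rho>"
    using assms by (auto intro: continuous_on_subset)
  then obtain x where "x \<in> {\<eta>..X}" "\<And>y. y \<in> {\<eta>..X} \<Longrightarrow> \<rho> x \<le> \<rho> y"
    using continuous_attains_inf[of "{\<eta>..X}" \<rho>] True by auto
  with that[of "\<rho> x"] assms show ?thesis by (auto simp: pos_def_def)
next
  case False
  \<comment> \<open>No \<open>s\<close> satisfies both bounds, so any positive constant
    serves.\<close>
  with that[of 1] show ?thesis by auto
qed

text \<open>The limit inferior controls \<open>\<rho>\<close> beyond some \<open>X\<close>,
  compactness controls it between \<open>\<eta>\<close> and \<open>X\<close>.\<close>

lemma pos_def_bounded_below_at_infinity:
  assumes "continuous_on {0..} \<rho>" "pos_def \<rho>" "0 < \<eta>"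
    and "Liminf at_top (\<lambda>s. ereal (\<rho> s)) > 0"
  obtains c where "0 < c" "\<And>s. \<eta> \<le> s \<Longrightarrow> c \<le> \<rho> s"
proof -
  obtain c1 where c1: "0 < ereal c1" "ereal c1 < Liminf at_top (\<lambda>s. ereal (\<rho> s))"
    using ereal_dense2 assms(4) by blast
  then have "eventually (\<lambda>s. c1 < \<rho> s) at_top"
    using less_LiminfD[OF c1(2)] by simp
  then obtain X where X: "\<And>s. X \<le> s \<Longrightarrow> c1 < \<rho> s"
    by (auto simp: eventually_at_top_linorder)
  obtain c where "0 < c" "\<And>s. \<eta> \<le> s \<Longrightarrow> s \<le> X \<Longrightarrow> c \<le> \<rho> s"
    using pos_def_bounded_below_on_Icc[OF assms(1-3)] by blast
  moreover have "min c c1 \<le> \<rho> s" if "\<eta> \<le> s" for s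
    using calculation(2)[of s] X[of s] that by (cases "s \<le> X") auto
  ultimately show ?thesis
    using that[of "min c c1"] c1 by simp
qed

lemma C1_bounded_above_on_cball:
  fixes V :: "'a::euclidean_space \<Rightarrow> real"
  assumes "C1_with_gradient V gV"
  obtains B where "0 \<le> B" "\<And>x. norm x \<le> R \<Longrightarrow> V x \<le> B"
proof -
  have "bounded (V ` cball 0 R)"
    using C1_continuous_on[OF assms] compact_continuous_image compact_imp_bounded compact_cball by blast
  then obtain B where "\<forall>x\<in>cball 0 R. norm (V x) \<le> B"
    by (auto simp: bounded_iff)
  then show ?thesis
    by (intro that[of "max 0 B"]) (force simp: le_max_iff_disj)+
qed

subsection \<open>Output attractivity and Lyapunov stability\<close>

text \<open>Both claims reduce to bringing \<open>W\<close> down to a suitable level at some time,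
  since the sublevel set is never left again. Near the origin this holds at time \<open>0\<close>;
  from farther away the decay of \<open>V\<close> enforces it.\<close>

lemma output_attractive_and_Lyapunov_stable:
  fixes f :: "'a::euclidean_space \<Rightarrow> 'b::euclidean_space \<Rightarrow> 'a"
    and h :: "'a \<Rightarrow> 'c::euclidean_space"
  assumes D_nonempty: "D \<noteq> {}"
    and f_zero: "\<And>d. d \<in> D \<Longrightarrow> f 0 d = 0"
    and V_C1: "C1_with_gradient V gV" and V_nonneg: "\<And>x. V x \<ge> 0"
    and W_C1: "C1_with_gradient W gW" and W_nonneg: "\<And>x. W x \<ge> 0"
    and rho: "continuous_on {0..} \<rho>" "pos_def \<rho>"
    and V_decay: "\<And>x d. d \<in> D \<Longrightarrow> gV x \<bullet> f x d \<le> - \<rho> (W x)"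
    and r_pos: "r > 0"
    and a_K: "a \<in> class_K"
    and W_lower: "\<And>x. W x < r \<Longrightarrow> a (norm (h x)) \<le> W x"
    and W_decay: "\<And>x d. W x < r \<Longrightarrow> d \<in> D \<Longrightarrow> gW x \<bullet> f x d \<le> 0"
    and alternatives:
      "Liminf at_top (\<lambda>s. ereal (\<rho> s)) > 0 \<or>
       (\<exists>\<zeta> Q gQ. \<zeta> \<in> class_K_inf \<and> C1_with_gradient Q gQ \<and> (\<forall>x. Q x \<ge> 0) \<and>
          (\<forall>x. W x \<le> \<zeta> (Q x)) \<and> (\<forall>x. \<forall>d\<in>D. gQ x \<bullet> f x d \<le> 0))"
  shows "URGOA D f h" "robustly_Lyapunov_output_stable D f h"
proof -
  \<comment> \<open>The bound \<open>r/2\<close> keeps the level strictly below \<open>r\<close>,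
    where the hypotheses on \<open>W\<close> apply; \<open>a \<epsilon>\<close> converts a bound on
    \<open>W\<close> into one on the output.\<close>
  define level where "level \<epsilon> = min (r/2) (a \<epsilon>)" for \<epsilon>
  have level: "0 < level \<epsilon>" "level \<epsilon> < r" if "\<epsilon> > 0" for \<epsilon>
    using class_K_pos[OF a_K that] r_pos by (auto simp: level_def)
  have stays: "norm (h (\<phi> t)) \<le> \<epsilon>"
    if "d \<in> inputs D" "solution f x0 d \<phi>" "0 \<le> s" "s \<le> t" "0 < \<epsilon>" "W (\<phi> s) \<le> level \<epsilon>"
    for d x0 \<phi> s t \<epsilon>
  proof -
    have "W (\<phi> t) \<le> W (\<phi> s)"
      by (rule nonincreasing_below_level[OF W_C1 that(2-4) inputs_in[OF that(1)] W_decay])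
        (use that level in force)+
    then have "W (\<phi> t) \<le> level \<epsilon>" using that by simp
    then have "a (norm (h (\<phi> t))) \<le> a \<epsilon>"
      using W_lower[of "\<phi> t"] level[OF \<open>0 < \<epsilon>\<close>] by (simp add: level_def)
    then show ?thesis using class_K_le_imp_le[OF a_K] \<open>0 < \<epsilon>\<close> by simp
  qed

  \<comment> \<open>At the equilibrium the left side of \<open>V_decay\<close> vanishes, which
    forces \<open>\<rho> (W 0) \<le> 0\<close>.\<close>
  have W0: "W 0 = 0"
  proof -
    obtain d where "d \<in> D" using D_nonempty by blast
    then have "\<rho> (W 0) \<le> 0" using V_decay[of d 0] f_zero by simp
    then show ?thesis
      using rho(2) W_nonneg[of 0] unfolding pos_def_def by (metis leD le_less)
  qed
  show "robustly_Lyapunov_output_stable D f h"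
    unfolding robustly_Lyapunov_output_stable_def
  proof (intro allI impI)
    fix \<epsilon> :: real assume "\<epsilon> > 0"
    have "isCont W 0"
      using C1_continuous_on[OF W_C1, of UNIV] by (simp add: continuous_on_eq_continuous_at)
    then obtain \<delta> where "\<delta> > 0" "\<And>x. dist x 0 < \<delta> \<Longrightarrow> dist (W x) (W 0) < level \<epsilon>"
      unfolding continuous_at_eps_delta using level[OF \<open>\<epsilon> > 0\<close>] by metis
    then have "norm x \<le> \<delta>/2 \<Longrightarrow> W x \<le> level \<epsilon>" for x
      using W0 by (smt (verit) dist_norm field_sum_of_halves diff_zero real_norm_def)
    with stays[where s = 0, OF _ _ _ _ \<open>\<epsilon> > 0\<close>] solution_at_0[of f] \<open>\<delta> > 0\<close>
    show "\<exists>\<delta>>0. \<forall>d\<in>inputs D. \<forall>x0 \<phi>. norm x0 \<le> \<delta> \<and> solution f x0 d \<phi> \<longrightarrow> (\<forall>t\<ge>0. norm (h (\<phi> t)) \<le> \<epsilon>)"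
      by (intro exI[of _ "\<delta>/2"]) fastforce
  qed

  \<comment> \<open>The constant may depend on \<open>\<eta>\<close> and \<open>R\<close> but not on
    the trajectory. In the second alternative \<open>Q\<close> is nonincreasing along trajectories,
    which confines \<open>W\<close> to values up to \<open>\<zeta> B\<close>.\<close>
  have rate: "\<exists>c>0. \<forall>d\<in>inputs D. \<forall>x0 \<phi>. norm x0 \<le> R \<and> solution f x0 d \<phi> \<longrightarrow>
      (\<forall>t\<ge>0. \<eta> \<le> W (\<phi> t) \<longrightarrow> c \<le> \<rho> (W (\<phi> t)))" if "\<eta> > 0" for \<eta> R
    using alternatives
  proof (elim disjE exE conjE)
    assume "Liminf at_top (\<lambda>s. ereal (\<rho> s)) > 0"
    then show ?thesis
      using pos_def_bounded_below_at_infinity[OF rho that] by metis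
  next
    fix \<zeta> Q gQ
    assume \<zeta>: "\<zeta> \<in> class_K_inf" and Q: "C1_with_gradient Q gQ" "\<forall>x. Q x \<ge> 0"
      and WQ: "\<forall>x. W x \<le> \<zeta> (Q x)" and Q_decay: "\<forall>x. \<forall>d\<in>D. gQ x \<bullet> f x d \<le> 0"
    obtain B where B: "0 \<le> B" "\<And>x. norm x \<le> R \<Longrightarrow> Q x \<le> B"
      using C1_bounded_above_on_cball[OF Q(1)] by blast
    have bound: "W (\<phi> t) \<le> \<zeta> B"
      if "d \<in> inputs D" "norm x0 \<le> R" "solution f x0 d \<phi>" "0 \<le> t" for d x0 \<phi> t
    proof -
      have "Q (\<phi> t) \<le> Q (\<phi> 0) - 0 * (t - 0)"
        by (rule decay_along_solution[OF Q(1) that(3)]) (use that(4) Q_decay inputs_in[OF that(1)] in simp_all)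
      also have "\<dots> \<le> B"
        using B(2)[OF that(2)] solution_at_0[OF that(3)] by simp
      finally have "\<zeta> (Q (\<phi> t)) \<le> \<zeta> B"
        using class_K_mono[of \<zeta> "Q (\<phi> t)" B] \<zeta> Q(2) by (simp add: class_K_inf_def)
      then show ?thesis using WQ order_trans by blast
    qed
    obtain c where "0 < c" "\<And>s. \<eta> \<le> s \<Longrightarrow> s \<le> \<zeta> B \<Longrightarrow> c \<le> \<rho> s"
      using pos_def_bounded_below_on_Icc[OF rho \<open>\<eta> > 0\<close>] by blast
    then show ?thesis using bound by metis
  qed

  show "URGOA D f h"
    unfolding URGOA_def
  proof (intro allI impI)
    fix \<epsilon> R :: real assume "\<epsilon> > 0" "R > 0"
    obtain c where c: "c > 0" "\<And>d x0 \<phi> t. d \<in> inputs D \<Longrightarrow> norm x0 \<le> R \<Longrightarrow> solution f x0 d \<phi> \<Longrightarrow>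
        0 \<le> t \<Longrightarrow> level \<epsilon> \<le> W (\<phi> t) \<Longrightarrow> c \<le> \<rho> (W (\<phi> t))"
      using rate[OF level(1)[OF \<open>\<epsilon> > 0\<close>], of R] by blast
    obtain B where B: "0 \<le> B" "\<And>x. norm x \<le> R \<Longrightarrow> V x \<le> B"
      using C1_bounded_above_on_cball[OF V_C1] by blast
    \<comment> \<open>While \<open>W\<close> is above the level, \<open>V\<close> loses at least
      \<open>c\<close> per unit of time, starting from at most \<open>B\<close>; the extra unit of
      time would make it negative.\<close>
    define T where "T = B / c + 1"
    have "T > 0" using B c by (simp add: T_def add_nonneg_pos)
    have "norm (h (\<phi> t)) \<le> \<epsilon>"
      if "d \<in> inputs D" "norm x0 \<le> R" "solution f x0 d \<phi>" "T \<le> t" for d x0 \<phi> t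
    proof -
      have "\<exists>s\<in>{0..T}. W (\<phi> s) \<le> level \<epsilon>"
      proof (rule ccontr)
        assume "\<not> ?thesis"
        then have large: "level \<epsilon> \<le> W (\<phi> \<sigma>)" if "0 \<le> \<sigma>" "\<sigma> \<le> T" for \<sigma>
          using that by force
        have "gV (\<phi> \<sigma>) \<bullet> f (\<phi> \<sigma>) (d \<sigma>) \<le> - c" if "0 \<le> \<sigma>" "\<sigma> \<le> T" for \<sigma>
          using V_decay[OF inputs_in[OF \<open>d \<in> inputs D\<close> \<open>0 \<le> \<sigma>\<close>], of "\<phi> \<sigma>"]
            c(2)[OF \<open>d \<in> inputs D\<close> \<open>norm x0 \<le> R\<close> \<open>solution f x0 d \<phi>\<close> \<open>0 \<le> \<sigma>\<close> large[OF that]]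
          by simp
        then have "V (\<phi> T) \<le> V (\<phi> 0) - c * (T - 0)"
          using \<open>T > 0\<close> by (intro decay_along_solution[OF V_C1 that(3)]) auto
        also have "\<dots> \<le> B - c * T" using B(2)[OF that(2)] solution_at_0[OF that(3)] by simp
        also have "\<dots> < 0" using c by (simp add: T_def field_simps)
        finally show False using V_nonneg[of "\<phi> T"] by simp
      qed
      then show ?thesis using stays[OF that(1,3)] \<open>T \<le> t\<close> \<open>\<epsilon> > 0\<close> by force
    qed
    then show "\<exists>T>0. \<forall>d\<in>inputs D. \<forall>x0 \<phi>. norm x0 \<le> R \<and> solution f x0 d \<phi> \<longrightarrow> (\<forall>t\<ge>T. norm (h (\<phi> t)) \<le> \<epsilon>)"
      using \<open>T > 0\<close> by blast
  qed
qed

subsection \<open>Gronwall estimates\<close>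

text \<open>The right side \<open>G\<close> of the inequality has derivative
  \<open>L * u t \<le> L * G t\<close>, so \<open>G t * exp (- L * t)\<close> is
  nonincreasing.\<close>

lemma gronwall_integral:
  fixes u :: "real \<Rightarrow> real"
  assumes "0 \<le> L" "0 \<le> T" and cont: "continuous_on {0..T} u"
    and le: "\<And>t. 0 \<le> t \<Longrightarrow> t \<le> T \<Longrightarrow> u t \<le> c + L * integral {0..t} u"
  shows "u T \<le> c * exp (L * T)"
proof -
  define G where "G t = c + L * integral {0..t} u" for t
  have intc: "continuous_on {0..T} (\<lambda>t. integral {0..t} u)"
    by (intro indefinite_integral_continuous_1 integrable_continuous_real cont)
  have "G T * exp (- L * T) \<le> G 0 * exp (- L * 0)"
  proof (rule DERIV_nonpos_imp_decreasing_open[OF \<open>0 \<le> T\<close>])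
    fix t assume t: "0 < t" "t < T"
    have "((\<lambda>x. integral {0..x} u) has_real_derivative u t) (at t within {0..T})"
      using integral_has_real_derivative[OF cont, of t] t by simp
    then have "((\<lambda>x. integral {0..x} u) has_real_derivative u t) (at t)"
      using t by (simp add: at_within_Icc_at)
    then have "((\<lambda>t. G t * exp (- L * t)) has_real_derivative
        (L * u t) * exp (- L * t) + G t * (exp (- L * t) * (- L))) (at t)"
      unfolding G_def by (auto intro!: derivative_eq_intros)
    moreover have "(L * u t) * exp (- L * t) + G t * (exp (- L * t) * (- L)) = L * (u t - G t) * exp (- L * t)"
      by (simp add: algebra_simps)
    moreover have "L * (u t - G t) * exp (- L * t) \<le> 0"
      using le[of t] t \<open>0 \<le> L\<close> by (intro mult_nonpos_nonneg mult_nonneg_nonpos) (auto simp: G_def)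
    ultimately show "\<exists>y. ((\<lambda>t. G t * exp (- L * t)) has_real_derivative y) (at t) \<and> y \<le> 0"
      by metis
  next
    show "continuous_on {0..T} (\<lambda>t. G t * exp (- L * t))"
      unfolding G_def by (intro continuous_intros intc)
  qed
  then have "G T \<le> c * exp (L * T)"
    by (simp add: G_def exp_minus field_simps)
  moreover have "u T \<le> G T"
    using le[of T] \<open>0 \<le> T\<close> by (simp add: G_def)
  ultimately show ?thesis by simp
qed

text \<open>The hypothesis is invariant under time reversal, which gives the second bound. That
  bound later yields injectivity of the flow and the uniform size of covered balls.\<close>

lemma gronwall_two_sided:
  fixes w :: "real \<Rightarrow> 'a::euclidean_space"
  assumes L: "0 \<le> L" "0 \<le> T" and cont: "continuous_on {0..T} w"
    and le: "\<And>a b. 0 \<le> a \<Longrightarrow> a \<le> b \<Longrightarrow> b \<le> T \<Longrightarrow>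
      norm (w b - w a) \<le> L * integral {a..b} (\<lambda>t. norm (w t))"
  shows "norm (w T) \<le> norm (w 0) * exp (L * T)" "norm (w 0) \<le> norm (w T) * exp (L * T)"
proof -
  show "norm (w T) \<le> norm (w 0) * exp (L * T)"
  proof (rule gronwall_integral[OF L])
    show "continuous_on {0..T} (\<lambda>t. norm (w t))" by (intro continuous_intros cont)
    show "norm (w t) \<le> norm (w 0) + L * integral {0..t} (\<lambda>t. norm (w t))" if "0 \<le> t" "t \<le> T" for t
      using le[of 0 t] that norm_triangle_sub[of "w t" "w 0"] by simp
  qed
  have "norm (w (T - T)) \<le> norm (w T) * exp (L * T)"
  proof (rule gronwall_integral[OF L, where u = "\<lambda>t. norm (w (T - t))"])
    show "continuous_on {0..T} (\<lambda>t. norm (w (T - t)))"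
      by (intro continuous_intros continuous_on_compose2[OF cont]) auto
    fix t assume t: "0 \<le> t" "t \<le> T"
    \<comment> \<open>The substitution of \<open>T - s\<close> for the time is a reflection followed
      by a translation.\<close>
    have "integral {T - t..T} (\<lambda>t. norm (w t)) = integral {- T..t - T} (\<lambda>s. norm (w (- s)))"
      using Henstock_Kurzweil_Integration.integral_reflect_real[of T "T - t" "\<lambda>s. norm (w s)"] by simp
    also have "\<dots> = integral {0..t} (\<lambda>s. norm (w (T - s)))"
      using integral_shift_real_ivl[of "- T" "- T" "t - T" "\<lambda>s. norm (w (- s))"] by simp
    finally show "norm (w (T - t)) \<le> norm (w T) + L * integral {0..t} (\<lambda>t. norm (w (T - t)))"
      using le[of "T - t" T] t norm_triangle_sub[of "w (T - t)" "w T"] by (simp add: norm_minus_commute)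
  qed
  then show "norm (w 0) \<le> norm (w T) * exp (L * T)" by simp
qed

text \<open>The difference of the solutions satisfies the Gronwall hypothesis. Conditions are
  imposed only for \<open>t < T\<close>, because consistent inputs agree only before a switching
  time and a first hitting time gives bounds only before it; the end point is negligible in the
  integrals.\<close>

lemma solutions_two_sided_estimate:
  fixes f :: "'a::euclidean_space \<Rightarrow> 'b::euclidean_space \<Rightarrow> 'a"
  assumes L: "0 \<le> L" "0 \<le> T"
    and lip: "\<And>x z d. x \<in> S \<Longrightarrow> z \<in> S \<Longrightarrow> d \<in> D \<Longrightarrow> norm (f x d - f z d) \<le> L * norm (x - z)"
    and sol: "solution f x0 d \<phi>" "solution f y0 e \<psi>"
    and d: "\<And>t. 0 \<le> t \<Longrightarrow> t < T \<Longrightarrow> e t = d t" "\<And>t. 0 \<le> t \<Longrightarrow> d t \<in> D"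
    and S: "\<And>t. 0 \<le> t \<Longrightarrow> t < T \<Longrightarrow> \<phi> t \<in> S" "\<And>t. 0 \<le> t \<Longrightarrow> t < T \<Longrightarrow> \<psi> t \<in> S"
  shows "norm (\<phi> T - \<psi> T) \<le> norm (x0 - y0) * exp (L * T)"
    "norm (x0 - y0) \<le> norm (\<phi> T - \<psi> T) * exp (L * T)"
proof -
  define w where "w t = \<phi> t - \<psi> t" for t
  have cont: "continuous_on {a..b} w" if "0 \<le> a" for a b
    unfolding w_def by (intro continuous_intros solution_continuous_on[OF sol(1)] solution_continuous_on[OF sol(2)] that)
  have le: "norm (w b - w a) \<le> L * integral {a..b} (\<lambda>t. norm (w t))"
    if ab: "0 \<le> a" "a \<le> b" "b \<le> T" for a b
  proof -
    have int: "(\<lambda>s. f (\<phi> s) (d s)) integrable_on {a..b}" "(\<lambda>s. f (\<psi> s) (e s)) integrable_on {a..b}"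
      using solution_integrable[OF sol(1)] solution_integrable[OF sol(2)] ab by auto
    have wi: "(\<lambda>t. L * norm (w t)) integrable_on {a..b}"
      by (intro integrable_continuous_real continuous_intros cont ab)
    have "w b - w a = integral {a..b} (\<lambda>s. f (\<phi> s) (d s)) - integral {a..b} (\<lambda>s. f (\<psi> s) (e s))"
      using solution_increment[OF sol(1), of a b] solution_increment[OF sol(2), of a b] ab
      unfolding w_def by (metis (no_types, lifting) add_diff_add add_diff_cancel_left')
    also have "\<dots> = integral {a..b} (\<lambda>s. f (\<phi> s) (d s) - f (\<psi> s) (e s))"
      using int by (simp add: integral_diff)
    also have "\<dots> = integral {a..<b} (\<lambda>s. f (\<phi> s) (d s) - f (\<psi> s) (e s))"
      by (rule integral_subset_negligible[symmetric]) (auto intro: negligible_subset[of "{b}"])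
    finally have eq: "w b - w a = integral {a..<b} (\<lambda>s. f (\<phi> s) (d s) - f (\<psi> s) (e s))" .
    have sub: "g integrable_on {a..b} \<Longrightarrow> g integrable_on {a..<b}" for g :: "real \<Rightarrow> 'z::euclidean_space"
      by (erule integrable_spike_set) (auto intro: negligible_subset[of "{b}"])
    have "norm (w b - w a) \<le> integral {a..<b} (\<lambda>t. L * norm (w t))"
      unfolding eq
    proof (rule integral_norm_bound_integral)
      show "(\<lambda>s. f (\<phi> s) (d s) - f (\<psi> s) (e s)) integrable_on {a..<b}"
        by (intro sub integrable_diff int)
      show "(\<lambda>t. L * norm (w t)) integrable_on {a..<b}"
        by (rule sub[OF wi])
      show "norm (f (\<phi> s) (d s) - f (\<psi> s) (e s)) \<le> L * norm (w s)" if "s \<in> {a..<b}" for s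
        using lip[OF S(1) S(2) d(2), of s s s] d(1)[of s] ab that by (simp add: w_def)
    qed
    also have "\<dots> = integral {a..b} (\<lambda>t. L * norm (w t))"
      by (rule integral_subset_negligible) (auto intro: negligible_subset[of "{b}"])
    finally show ?thesis by simp
  qed
  show "norm (\<phi> T - \<psi> T) \<le> norm (x0 - y0) * exp (L * T)"
    "norm (x0 - y0) \<le> norm (\<phi> T - \<psi> T) * exp (L * T)"
    using gronwall_two_sided[OF L cont[OF order_refl] le] solution_at_0[OF sol(1)] solution_at_0[OF sol(2)]
    by (simp_all add: w_def)
qed

subsection \<open>Shifting and concatenating inputs\<close>

text \<open>It glues both inputs and trajectories; the second function runs on its own clock,
  restarted at \<open>0\<close>.\<close>

definition concat_at :: "real \<Rightarrow> (real \<Rightarrow> 'a) \<Rightarrow> (real \<Rightarrow> 'a) \<Rightarrow> real \<Rightarrow> 'a" where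
  "concat_at \<tau> u v = (\<lambda>t. if t < \<tau> then u t else v (t - \<tau>))"

text \<open>A bound on \<open>D\<close> supplies the local essential bounds.\<close>

lemma inputs_bounded_iff:
  assumes "bounded D"
  shows "d \<in> inputs D \<longleftrightarrow> d \<in> borel_measurable (lebesgue_on {0..}) \<and> (\<forall>t\<ge>0. d t \<in> D)"
proof -
  obtain B where B: "\<forall>x\<in>D. norm x \<le> B" using assms by (auto simp: bounded_iff)
  have "AE t in lebesgue_on {0..T}. norm (d t) \<le> B" if "\<forall>t\<ge>0. d t \<in> D" for T
    using that B by (intro AE_I2) (simp add: space_restrict_space)
  then show ?thesis unfolding inputs_def by blast
qed

text \<open>Inputs are unconstrained at negative times; the zero extension is measurable on the
  whole line, where translation and case distinction preserve measurability.\<close>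

lemma extend_by_zero_measurable:
  fixes d :: "real \<Rightarrow> 'b::euclidean_space"
  assumes "d \<in> inputs D"
  shows "(\<lambda>t. if t \<in> {0..} then d t else 0) \<in> borel_measurable lebesgue"
  by (rule borel_measurable_if_I) (use assms in \<open>auto simp: inputs_def\<close>)

lemma inputs_shift:
  fixes d :: "real \<Rightarrow> 'b::euclidean_space"
  assumes D: "bounded D" and d: "d \<in> inputs D" and "0 \<le> s"
  shows "(\<lambda>t. d (s + t)) \<in> inputs D"
proof -
  have "(\<lambda>t. if s + 1 *\<^sub>R t \<in> {0..} then d (s + 1 *\<^sub>R t) else 0) \<in> borel_measurable lebesgue"
    using borel_measurable_affine[OF extend_by_zero_measurable[OF d], of 1 s] by simp
  then have "(\<lambda>t. if s + 1 *\<^sub>R t \<in> {0..} then d (s + 1 *\<^sub>R t) else 0) \<in> borel_measurable (lebesgue_on {0..})"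
    by (rule measurable_restrict_space1)
  moreover have "(\<lambda>t. d (s + t)) \<in> borel_measurable (lebesgue_on {0..}) \<longleftrightarrow>
      (\<lambda>t. if s + 1 *\<^sub>R t \<in> {0..} then d (s + 1 *\<^sub>R t) else 0) \<in> borel_measurable (lebesgue_on {0..})"
    by (rule measurable_cong) (use \<open>0 \<le> s\<close> in \<open>simp add: space_restrict_space\<close>)
  ultimately show ?thesis
    using d \<open>0 \<le> s\<close> by (simp add: inputs_bounded_iff[OF D])
qed

lemma inputs_concat:
  fixes u v :: "real \<Rightarrow> 'b::euclidean_space"
  assumes D: "bounded D" and u: "u \<in> inputs D" and v: "v \<in> inputs D"
  shows "concat_at \<tau> u v \<in> inputs D"
proof -
  have U: "(\<lambda>t. if t \<in> {0..} then u t else 0) \<in> borel_measurable lebesgue"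
    by (rule extend_by_zero_measurable[OF u])
  have V: "(\<lambda>t. if - \<tau> + 1 *\<^sub>R t \<in> {0..} then v (- \<tau> + 1 *\<^sub>R t) else 0) \<in> borel_measurable lebesgue"
    by (rule borel_measurable_affine[OF extend_by_zero_measurable[OF v]]) simp
  have "(\<lambda>t. if t \<in> {..<\<tau>} then (if t \<in> {0..} then u t else 0)
      else (if - \<tau> + 1 *\<^sub>R t \<in> {0..} then v (- \<tau> + 1 *\<^sub>R t) else 0)) \<in> borel_measurable lebesgue" (is "?w \<in> _")
    by (rule measurable_If_set[OF U V]) auto
  then have "?w \<in> borel_measurable (lebesgue_on {0..})"
    by (rule measurable_restrict_space1)
  moreover have "concat_at \<tau> u v \<in> borel_measurable (lebesgue_on {0..}) \<longleftrightarrow> ?w \<in> borel_measurable (lebesgue_on {0..})"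
    by (rule measurable_cong) (simp add: space_restrict_space concat_at_def)
  ultimately show ?thesis
    using u v by (simp add: inputs_bounded_iff[OF D] concat_at_def)
qed

lemma inputs_const:
  assumes "bounded D" "c \<in> D"
  shows "(\<lambda>t. c) \<in> inputs D"
  using assms by (simp add: inputs_bounded_iff)

lemma solution_shift:
  assumes sol: "solution f x0 d \<phi>" and "0 \<le> s"
  shows "solution f (\<phi> s) (\<lambda>t. d (s + t)) (\<lambda>t. \<phi> (s + t))"
  unfolding solution_def
proof (intro allI impI conjI)
  fix t :: real assume "0 \<le> t"
  have "(\<lambda>\<sigma>. f (\<phi> \<sigma>) (d \<sigma>)) absolutely_integrable_on {s..s + t}"
    by (rule solution_absolutely_integrable[OF sol \<open>0 \<le> s\<close>])
  then show "(\<lambda>\<sigma>. f (\<phi> (s + \<sigma>)) (d (s + \<sigma>))) absolutely_integrable_on {0..t}"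
    using integrable_shift_real_ivl[of "\<lambda>\<sigma>. f (\<phi> \<sigma>) (d \<sigma>)" s "s + t" s]
      integrable_shift_real_ivl[of "\<lambda>\<sigma>. norm (f (\<phi> \<sigma>) (d \<sigma>))" s "s + t" s]
    by (simp add: absolutely_integrable_on_def add.commute)
  have "\<phi> (s + t) = \<phi> s + integral {s..s + t} (\<lambda>\<sigma>. f (\<phi> \<sigma>) (d \<sigma>))"
    by (rule solution_increment[OF sol]) (use \<open>0 \<le> s\<close> \<open>0 \<le> t\<close> in auto)
  also have "integral {s..s + t} (\<lambda>\<sigma>. f (\<phi> \<sigma>) (d \<sigma>)) = integral {0..t} (\<lambda>\<sigma>. f (\<phi> (s + \<sigma>)) (d (s + \<sigma>)))"
    using integral_shift_real_ivl[of s s "s + t" "\<lambda>\<sigma>. f (\<phi> \<sigma>) (d \<sigma>)"] by (simp add: add.commute)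
  finally show "\<phi> (s + t) = \<phi> s + integral {0..t} (\<lambda>\<sigma>. f (\<phi> (s + \<sigma>)) (d (s + \<sigma>)))" .
qed

text \<open>The glued integrand is the first one before \<open>\<tau>\<close> and a translate of the
  second one afterwards; the integrals add up because \<open>\<psi>\<close> starts at
  \<open>\<phi> \<tau>\<close>.\<close>

lemma solution_concat:
  assumes sol1: "solution f x0 u \<phi>" and sol2: "solution f (\<phi> \<tau>) v \<psi>" and "0 \<le> \<tau>"
  shows "solution f x0 (concat_at \<tau> u v) (concat_at \<tau> \<phi> \<psi>)"
  unfolding solution_def
proof (intro allI impI)
  fix t :: real assume "0 \<le> t"
  define g where "g = (\<lambda>\<sigma>. f (concat_at \<tau> \<phi> \<psi> \<sigma>) (concat_at \<tau> u v \<sigma>))"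
  have g_less: "g \<sigma> = f (\<phi> \<sigma>) (u \<sigma>)" if "\<sigma> < \<tau>" for \<sigma>
    using that by (simp add: g_def concat_at_def)
  have left_abs: "g absolutely_integrable_on {0..b}"
    and left_eq: "\<phi> b = x0 + integral {0..b} g" if "0 \<le> b" "b \<le> \<tau>" for b
  proof -
    \<comment> \<open>At \<open>\<tau>\<close> itself the glued integrand is already the second one,
      hence the exceptional point.\<close>
    show "g absolutely_integrable_on {0..b}"
      by (rule absolutely_integrable_spike[OF solution_absolutely_integrable[OF sol1 order_refl], of "{\<tau>}"])
        (use that in \<open>auto intro: g_less\<close>)
    have "\<phi> b = x0 + integral {0..b} (\<lambda>\<sigma>. f (\<phi> \<sigma>) (u \<sigma>))"
      using sol1 \<open>0 \<le> b\<close> by (simp add: solution_def)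
    also have "integral {0..b} (\<lambda>\<sigma>. f (\<phi> \<sigma>) (u \<sigma>)) = integral {0..b} g"
      by (rule integral_spike[of "{\<tau>}"]) (use that in \<open>auto intro: g_less\<close>)
    finally show "\<phi> b = x0 + integral {0..b} g" .
  qed
  have "g absolutely_integrable_on {0..t} \<and> concat_at \<tau> \<phi> \<psi> t = x0 + integral {0..t} g"
  proof (cases "t < \<tau>")
    case True
    then show ?thesis using left_abs left_eq \<open>0 \<le> t\<close> by (simp add: concat_at_def)
  next
    case False
    define k where "k = (\<lambda>\<sigma>. f (\<psi> \<sigma>) (v \<sigma>))"
    have gk: "g \<sigma> = k (\<sigma> + (- \<tau>))" if "\<sigma> \<in> {\<tau>..t}" for \<sigma>
      using that by (simp add: g_def k_def concat_at_def)
    have k: "k integrable_on {0..t - \<tau>}" "(\<lambda>\<sigma>. norm (k \<sigma>)) integrable_on {0..t - \<tau>}"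
      using solution_absolutely_integrable[OF sol2 order_refl, of "t - \<tau>"]
      by (auto simp: absolutely_integrable_on_def k_def)
    have "(\<lambda>\<sigma>. k (\<sigma> + (- \<tau>))) integrable_on {\<tau>..t}" "(\<lambda>\<sigma>. norm (k (\<sigma> + (- \<tau>)))) integrable_on {\<tau>..t}"
      using integrable_shift_real_ivl[OF k(1), of "- \<tau>"] integrable_shift_real_ivl[OF k(2), of "- \<tau>"] by simp_all
    then have "g integrable_on {\<tau>..t}" "(\<lambda>\<sigma>. norm (g \<sigma>)) integrable_on {\<tau>..t}"
      by (auto elim!: integrable_eq simp: gk)
    then have right_abs: "g absolutely_integrable_on {\<tau>..t}"
      by (simp add: absolutely_integrable_on_def)
    have "integral {\<tau>..t} g = integral {\<tau>..t} (\<lambda>\<sigma>. k (\<sigma> + (- \<tau>)))"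
      by (rule Henstock_Kurzweil_Integration.integral_cong) (rule gk)
    also have "\<dots> = integral {0..t - \<tau>} k"
      using integral_shift_real_ivl[of 0 "- \<tau>" "t - \<tau>" k] by simp
    finally have "\<psi> (t - \<tau>) = \<phi> \<tau> + integral {\<tau>..t} g"
      using sol2 False by (simp add: solution_def k_def)
    moreover have abs: "g absolutely_integrable_on {0..t}"
      by (rule absolutely_integrable_on_combine[OF left_abs[OF \<open>0 \<le> \<tau>\<close> order_refl] right_abs])
        (use False \<open>0 \<le> \<tau>\<close> in auto)
    moreover have "integral {0..\<tau>} g + integral {\<tau>..t} g = integral {0..t} g"
      by (rule Henstock_Kurzweil_Integration.integral_combine)
        (use False \<open>0 \<le> \<tau>\<close> abs in \<open>auto simp: absolutely_integrable_on_def\<close>)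
    ultimately show ?thesis
      using left_eq[of \<tau>] False \<open>0 \<le> \<tau>\<close> by (simp add: concat_at_def algebra_simps)
  qed
  then show "(\<lambda>\<sigma>. f (concat_at \<tau> \<phi> \<psi> \<sigma>) (concat_at \<tau> u v \<sigma>)) absolutely_integrable_on {0..t} \<and>
      concat_at \<tau> \<phi> \<psi> t = x0 + integral {0..t} (\<lambda>\<sigma>. f (concat_at \<tau> \<phi> \<psi> \<sigma>) (concat_at \<tau> u v \<sigma>))"
    by (simp add: g_def)
qed

text \<open>Consistency makes the limit well defined before each \<open>T k\<close>; it is
  measurable as a pointwise limit of inputs.\<close>

lemma limit_of_consistent_inputs:
  fixes v :: "nat \<Rightarrow> real \<Rightarrow> 'b::euclidean_space"
  assumes D: "bounded D" "D \<noteq> {}" and v: "\<And>k. v k \<in> inputs D"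
    and T: "\<And>k. T k \<le> T (Suc k)"
    and ext: "\<And>k t. t < T k \<Longrightarrow> v (Suc k) t = v k t"
  obtains w where "w \<in> inputs D" "\<And>k t. t < T k \<Longrightarrow> w t = v k t"
proof -
  have mono: "j \<le> k \<Longrightarrow> T j \<le> T k" for j k
    by (rule lift_Suc_mono_le[of T, OF T])
  have cons: "v k t = v j t" if "j \<le> k" "t < T j" for j k t
    using that(1)
  proof (induction k rule: dec_induct)
    case (step n)
    then show ?case using ext[of t n] mono[OF step.hyps(1)] that(2) by simp
  qed simp
  obtain d0 where d0: "d0 \<in> D" using D by blast
  \<comment> \<open>The default \<open>d0\<close> keeps the values in \<open>D\<close> at times that
    no \<open>T k\<close> exceeds.\<close>
  define w where "w t = (if \<exists>k. t < T k then v (LEAST k. t < T k) t else d0)" for t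
  have w: "w t = v k t" if "t < T k" for k t
  proof -
    have "w t = v (LEAST k. t < T k) t" using that by (auto simp: w_def)
    also have "\<dots> = v k t"
      by (rule cons[symmetric]) (use that in \<open>auto intro: Least_le LeastI\<close>)
    finally show ?thesis .
  qed
  have "w \<in> borel_measurable (lebesgue_on {0..})"
  proof (rule borel_measurable_LIMSEQ_metric)
    \<comment> \<open>Cutting \<open>v k\<close> off at \<open>T k\<close> forces convergence
      everywhere, including times beyond all \<open>T k\<close>, where \<open>v k\<close> itself is
      uncontrolled.\<close>
    show "concat_at (T k) (v k) (\<lambda>_. d0) \<in> borel_measurable (lebesgue_on {0..})" for k
      using inputs_concat[OF D(1) v inputs_const[OF D(1) d0]] inputs_bounded_iff[OF D(1)] by blast
    show "(\<lambda>k. concat_at (T k) (v k) (\<lambda>_. d0) t) \<longlonglongrightarrow> w t" for t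
    proof (cases "\<exists>k. t < T k")
      case True
      then obtain k where k: "t < T k" by blast
      have "\<forall>\<^sub>F n in sequentially. concat_at (T n) (v n) (\<lambda>_. d0) t = w t"
        using eventually_ge_at_top[of k]
      proof eventually_elim
        case (elim n)
        then have "t < T n" using k mono[of k n] by simp
        then show ?case using w[of t n] by (simp add: concat_at_def)
      qed
      then show ?thesis by (rule tendsto_eventually)
    next
      case False
      then show ?thesis by (auto simp: concat_at_def w_def)
    qed
  qed
  moreover have "w t \<in> D" if "0 \<le> t" for t
    using d0 v[THEN inputs_in] that by (simp add: w_def)
  ultimately show ?thesis
    using that[of w] w by (simp add: inputs_bounded_iff[OF D(1)])
qed

subsection \<open>Boundedness of reachable sets\<close>

text \<open>A small move along the segment towards \<open>z\<close> stays in \<open>A\<close>. Hence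
  a point of an open set that is nearest to \<open>z\<close> must be \<open>z\<close>.\<close>

lemma open_contains_closer_point:
  fixes p z :: "'z::real_normed_vector"
  assumes "open A" "p \<in> A" "p \<noteq> z"
  obtains q where "q \<in> A" "dist q z < dist p z"
proof -
  obtain e where e: "e > 0" "ball p e \<subseteq> A" using assms open_contains_ball by blast
  \<comment> \<open>The move has length at most \<open>e/2\<close> and does not pass
    \<open>z\<close>.\<close>
  define c where "c = min 1 (e / (2 * norm (z - p)))"
  have c: "0 < c" "c \<le> 1" using e assms by (auto simp: c_def)
  have "c * norm (z - p) \<le> e / (2 * norm (z - p)) * norm (z - p)"
    by (intro mult_right_mono) (auto simp: c_def)
  also have "\<dots> < e" using e assms by (simp add: field_simps)
  finally have "p + c *\<^sub>R (z - p) \<in> A"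
    using e c by (intro subsetD[OF e(2)]) (simp add: dist_norm)
  moreover have "dist (p + c *\<^sub>R (z - p)) z = (1 - c) * dist p z"
  proof -
    have "p + c *\<^sub>R (z - p) - z = (1 - c) *\<^sub>R (p - z)" by (simp add: algebra_simps)
    then show ?thesis using c by (simp add: dist_norm)
  qed
  moreover have "(1 - c) * dist p z < 1 * dist p z"
    using c assms by (intro mult_strict_right_mono) auto
  ultimately show ?thesis using that by simp
qed

lemma inverse_Suc_eventually_less:
  assumes "0 < (e::real)" "strict_mono (k :: nat \<Rightarrow> nat)"
  shows "\<forall>\<^sub>F n in sequentially. inverse (real (Suc (k n))) < e"
proof -
  have "(\<lambda>n. inverse (real (Suc (k n)))) \<longlonglongrightarrow> 0"
    using LIMSEQ_subseq_LIMSEQ[OF LIMSEQ_inverse_real_of_nat assms(2)] by (simp add: o_def)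
  then show ?thesis using assms(1) by (rule order_tendstoD(2))
qed

lemma real_subseq_eventually_greater:
  assumes "strict_mono (k :: nat \<Rightarrow> nat)"
  shows "\<forall>\<^sub>F n in sequentially. M < real (k n)"
  using filterlim_compose[OF filterlim_real_sequentially filterlim_subseq[OF assms]]
  by (simp add: filterlim_at_top_dense)

section \<open>Flow maps of a forward complete system with bounded input set\<close>

locale bounded_input_system =
  fixes D :: "'b::euclidean_space set" and f :: "'a::euclidean_space \<Rightarrow> 'b \<Rightarrow> 'a"
  assumes D_bounded: "bounded D" and D_nonempty: "D \<noteq> {}"
    and lipschitz: "\<And>S. compact S \<Longrightarrow>
      \<exists>L>0. \<forall>x\<in>S. \<forall>z\<in>S. \<forall>d\<in>D. norm (f x d - f z d) \<le> L * norm (x - z)"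
    and complete: "forward_complete D f"
begin

text \<open>An arbitrary choice suffices: for an input, solutions are unique at times
  \<open>t \<ge> 0\<close>, and only those times matter.\<close>

definition flow :: "(real \<Rightarrow> 'b) \<Rightarrow> 'a \<Rightarrow> real \<Rightarrow> 'a" where
  "flow u x = (SOME \<phi>. solution f x u \<phi>)"

lemma flow_solution: "u \<in> inputs D \<Longrightarrow> solution f x u (flow u x)"
  using complete unfolding forward_complete_def flow_def by (metis someI)

lemma flow_0: "u \<in> inputs D \<Longrightarrow> flow u x 0 = x"
  using flow_solution solution_at_0 by blast

lemma flow_continuous: "u \<in> inputs D \<Longrightarrow> continuous_on {0..T} (flow u x)"
  using flow_solution solution_continuous_on by blast

lemma flow_bounded:
  assumes "u \<in> inputs D"
  obtains B where "\<And>t. 0 \<le> t \<Longrightarrow> t \<le> T \<Longrightarrow> norm (flow u x t) \<le> B"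
proof -
  have "bounded (flow u x ` {0..T})"
    using compact_continuous_image[OF flow_continuous[OF assms]] compact_imp_bounded compact_Icc by blast
  then obtain B where "\<forall>y\<in>flow u x ` {0..T}. norm y \<le> B"
    by (auto simp: bounded_iff)
  then show ?thesis by (intro that[of B]) simp
qed

text \<open>Up to time \<open>T\<close> both trajectories lie in one compact set, so both Gronwall
  bounds apply: one gives uniqueness, the other injectivity in the initial value.\<close>

lemma solutions_agree:
  assumes u: "u \<in> inputs D" and sol: "solution f x u \<phi>" "solution f y v \<psi>" and "0 \<le> T"
    and uv: "\<And>t. 0 \<le> t \<Longrightarrow> t < T \<Longrightarrow> v t = u t"
  shows "x = y \<longleftrightarrow> \<phi> T = \<psi> T"
proof -
  define S where "S = \<phi> ` {0..T} \<union> \<psi> ` {0..T}"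
  have "compact S"
    unfolding S_def using sol
    by (intro compact_Un compact_continuous_image solution_continuous_on) auto
  then obtain L where L: "L > 0"
    "\<And>x z d. x \<in> S \<Longrightarrow> z \<in> S \<Longrightarrow> d \<in> D \<Longrightarrow> norm (f x d - f z d) \<le> L * norm (x - z)"
    using lipschitz by metis
  have S: "\<phi> t \<in> S" "\<psi> t \<in> S" if "0 \<le> t" "t < T" for t
    using that by (auto simp: S_def)
  have "norm (\<phi> T - \<psi> T) \<le> norm (x - y) * exp (L * T)" "norm (x - y) \<le> norm (\<phi> T - \<psi> T) * exp (L * T)"
    using solutions_two_sided_estimate[OF less_imp_le[OF L(1)] \<open>0 \<le> T\<close> L(2) sol uv inputs_in[OF u] S]
    by simp_all
  then show ?thesis by auto
qed

lemma flow_unique: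
  assumes "u \<in> inputs D" "solution f x u \<phi>" "0 \<le> t"
  shows "\<phi> t = flow u x t"
  using solutions_agree[OF assms(1,2) flow_solution[OF assms(1), of x] assms(3)] by simp

lemma flow_cong:
  assumes "u \<in> inputs D" "v \<in> inputs D" "0 \<le> T" "\<And>t. 0 \<le> t \<Longrightarrow> t < T \<Longrightarrow> v t = u t"
  shows "flow v x T = flow u x T"
  using solutions_agree[OF assms(1) flow_solution[OF assms(1)] flow_solution[OF assms(2)] assms(3,4)]
  by metis

lemma flow_inj:
  assumes "u \<in> inputs D" "0 \<le> t"
  shows "inj (\<lambda>x. flow u x t)"
  using solutions_agree[OF assms(1) flow_solution[OF assms(1)] flow_solution[OF assms(1)] assms(2)]
  by (auto intro: injI)

lemma flow_shift:
  assumes u: "u \<in> inputs D" and "0 \<le> s" "0 \<le> t"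
  shows "flow (\<lambda>t. u (s + t)) (flow u x s) t = flow u x (s + t)"
  using flow_unique[OF inputs_shift[OF D_bounded u \<open>0 \<le> s\<close>] solution_shift[OF flow_solution[OF u] \<open>0 \<le> s\<close>] \<open>0 \<le> t\<close>]
  by simp

lemma flow_concat:
  assumes u: "u \<in> inputs D" and v: "v \<in> inputs D" and "0 \<le> s" "0 \<le> t"
  shows "flow (concat_at s u v) x (s + t) = flow v (flow u x s) t"
  using flow_unique[OF inputs_concat[OF D_bounded u v]
      solution_concat[OF flow_solution[OF u] flow_solution[OF v] \<open>0 \<le> s\<close>], of "s + t" x] assms
  by (simp add: concat_at_def)

text \<open>One constant serves all inputs, all times up to \<open>T\<close> and all trajectories
  bounded by \<open>R\<close>. Smallness of \<open>norm (x - y) * C\<close> keeps the second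
  trajectory within distance \<open>1\<close> of the first, hence in the ball of radius
  \<open>R + 1\<close> that provides the Lipschitz constant.\<close>

lemma flow_two_sided_estimate:
  obtains C where "1 \<le> C"
    "\<And>u s x y. \<lbrakk>u \<in> inputs D; 0 \<le> s; s \<le> T; \<And>t. 0 \<le> t \<Longrightarrow> t \<le> s \<Longrightarrow> norm (flow u x t) \<le> R;
      norm (x - y) * C < 1\<rbrakk> \<Longrightarrow>
      norm (flow u x s - flow u y s) \<le> norm (x - y) * C \<and>
      norm (x - y) \<le> norm (flow u x s - flow u y s) * C"
proof -
  define S where "S = cball (0::'a) (R + 1)"
  obtain L where L: "L > 0"
    "\<And>x z d. x \<in> S \<Longrightarrow> z \<in> S \<Longrightarrow> d \<in> D \<Longrightarrow> norm (f x d - f z d) \<le> L * norm (x - z)"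
    using lipschitz[of S] by (auto simp: S_def)
  \<comment> \<open>The maximum gives \<open>1 \<le> C\<close> for negative \<open>T\<close>
    too.\<close>
  define C where "C = exp (L * max 0 T)"
  have "1 \<le> C" using L by (simp add: C_def)
  have expC: "exp (L * s) \<le> C" if "s \<le> T" for s
    using L that by (simp add: C_def)
  show ?thesis
  proof (rule that[OF \<open>1 \<le> C\<close>])
    fix u s x y
    assume u: "u \<in> inputs D" and s: "0 \<le> s" "s \<le> T"
      and R: "\<And>t. 0 \<le> t \<Longrightarrow> t \<le> s \<Longrightarrow> norm (flow u x t) \<le> R"
      and small: "norm (x - y) * C < 1"
    have est: "norm (flow u x \<tau> - flow u y \<tau>) \<le> norm (x - y) * C"
      "norm (x - y) \<le> norm (flow u x \<tau> - flow u y \<tau>) * C"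
      if \<tau>: "0 \<le> \<tau>" "\<tau> \<le> s" and near: "\<And>t. 0 \<le> t \<Longrightarrow> t < \<tau> \<Longrightarrow> norm (flow u x t - flow u y t) < 1" for \<tau>
    proof -
      have S: "flow u x t \<in> S" "flow u y t \<in> S" if "0 \<le> t" "t < \<tau>" for t
        using R[of t] near[of t] that \<tau> norm_triangle_sub[of "flow u y t" "flow u x t"]
        by (auto simp: S_def norm_minus_commute)
      have "norm (flow u x \<tau> - flow u y \<tau>) \<le> norm (x - y) * exp (L * \<tau>)"
        "norm (x - y) \<le> norm (flow u x \<tau> - flow u y \<tau>) * exp (L * \<tau>)"
        using solutions_two_sided_estimate[OF less_imp_le[OF L(1)] \<tau>(1) L(2)
            flow_solution[OF u] flow_solution[OF u] refl inputs_in[OF u] S]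
        by simp_all
      then show "norm (flow u x \<tau> - flow u y \<tau>) \<le> norm (x - y) * C"
        "norm (x - y) \<le> norm (flow u x \<tau> - flow u y \<tau>) * C"
        using expC[of \<tau>] \<tau> s by (meson mult_left_mono norm_ge_zero order_trans)+
    qed
    have cont: "continuous_on {0..t} (\<lambda>t. norm (flow u x t - flow u y t))" for t
      by (intro continuous_intros flow_continuous u)
    have "norm (x - y) * 1 \<le> norm (x - y) * C"
      using \<open>1 \<le> C\<close> by (rule mult_left_mono) simp
    then have start: "norm (flow u x 0 - flow u y 0) < 1"
      using small by (simp add: flow_0 u)
    \<comment> \<open>At the first time with distance \<open>1\<close> the estimate would already
      give a distance below \<open>1\<close>.\<close>
    have "norm (flow u x t - flow u y t) < 1" if t: "0 \<le> t" "t < s" for t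
    proof (rule ccontr)
      assume "\<not> ?thesis"
      then have "1 \<le> norm (flow u x t - flow u y t)" by simp
      from first_hitting_time[OF cont \<open>0 \<le> t\<close> start this]
      obtain \<tau> where \<tau>: "0 < \<tau>" "\<tau> \<le> t" "norm (flow u x \<tau> - flow u y \<tau>) = 1"
        "\<And>\<sigma>. 0 \<le> \<sigma> \<Longrightarrow> \<sigma> < \<tau> \<Longrightarrow> norm (flow u x \<sigma> - flow u y \<sigma>) < 1"
        by blast
      have "norm (flow u x \<tau> - flow u y \<tau>) \<le> norm (x - y) * C"
        by (rule est(1)) (use \<tau> t in auto)
      then show False using \<tau>(3) small by simp
    qed
    then show "norm (flow u x s - flow u y s) \<le> norm (x - y) * C \<and>
      norm (x - y) \<le> norm (flow u x s - flow u y s) * C"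
      using est[OF s(1) order_refl] by blast
  qed
qed

lemma flow_continuous_initial:
  assumes u: "u \<in> inputs D" and "0 \<le> s"
  shows "continuous_on A (\<lambda>x. flow u x s)"
proof (rule continuous_at_imp_continuous_on, rule ballI)
  fix x
  obtain B where B: "\<And>t. 0 \<le> t \<Longrightarrow> t \<le> s \<Longrightarrow> norm (flow u x t) \<le> B"
    using flow_bounded[OF u] by blast
  obtain C where C: "1 \<le> C"
    and est: "\<And>y. norm (x - y) * C < 1 \<Longrightarrow> norm (flow u x s - flow u y s) \<le> norm (x - y) * C"
    using flow_two_sided_estimate[of s B] B u \<open>0 \<le> s\<close> by (metis order_refl)
  show "isCont (\<lambda>x. flow u x s) x"
    unfolding continuous_at_eps_delta
  proof (intro allI impI)
    fix e :: real assume "e > 0"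
    have "dist (flow u y s) (flow u x s) < e" if "dist y x < min 1 e / C" for y
    proof -
      have "norm (x - y) * C < min 1 e"
        using that C by (simp add: dist_norm norm_minus_commute field_simps)
      with est[of y] show ?thesis by (simp add: dist_norm norm_minus_commute)
    qed
    then show "\<exists>d>0. \<forall>y. dist y x < d \<longrightarrow> dist (flow u y s) (flow u x s) < e"
      using \<open>e > 0\<close> C by (intro exI[of _ "min 1 e / C"]) auto
  qed
qed

lemma flow_open_image:
  assumes "u \<in> inputs D" "0 \<le> s" "open A"
  shows "open ((\<lambda>x. flow u x s) ` A)"
  using invariance_of_domain[OF flow_continuous_initial[OF assms(1,2)] assms(3)] flow_inj[OF assms(1,2)]
    inj_on_subset by blast

text \<open>A point of \<open>cball x \<epsilon>\<close> whose image is closest to \<open>z\<close> is interior by the lower estimate, and then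
  its image must be \<open>z\<close> because the flow is an open map.\<close>

lemma flow_covers_ball:
  obtains C where "1 \<le> C"
    "\<And>u s x \<epsilon> z. \<lbrakk>u \<in> inputs D; 0 \<le> s; s \<le> T; \<And>t. 0 \<le> t \<Longrightarrow> t \<le> s \<Longrightarrow> norm (flow u x t) \<le> R;
      0 < \<epsilon>; \<epsilon> * C < 1; dist (flow u x s) z < \<epsilon> / (2 * C)\<rbrakk> \<Longrightarrow> \<exists>y\<in>cball x \<epsilon>. flow u y s = z"
proof -
  obtain C where "1 \<le> C" and est:
    "\<And>u s x y. \<lbrakk>u \<in> inputs D; 0 \<le> s; s \<le> T; \<And>t. 0 \<le> t \<Longrightarrow> t \<le> s \<Longrightarrow> norm (flow u x t) \<le> R;
      norm (x - y) * C < 1\<rbrakk> \<Longrightarrow>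
      norm (flow u x s - flow u y s) \<le> norm (x - y) * C \<and>
      norm (x - y) \<le> norm (flow u x s - flow u y s) * C"
    using flow_two_sided_estimate[of T R] by blast
  show ?thesis
  proof (rule that[OF \<open>1 \<le> C\<close>])
    fix u s x \<epsilon> z
    assume u: "u \<in> inputs D" and s: "0 \<le> s" "s \<le> T"
      and R: "\<And>t. 0 \<le> t \<Longrightarrow> t \<le> s \<Longrightarrow> norm (flow u x t) \<le> R"
      and \<epsilon>: "0 < \<epsilon>" "\<epsilon> * C < 1" and z: "dist (flow u x s) z < \<epsilon> / (2 * C)"
    have "continuous_on (cball x \<epsilon>) (\<lambda>y. dist (flow u y s) z)"
      by (intro continuous_intros flow_continuous_initial u s)
    then obtain y where y: "y \<in> cball x \<epsilon>"
      and min: "\<And>y'. y' \<in> cball x \<epsilon> \<Longrightarrow> dist (flow u y s) z \<le> dist (flow u y' s) z"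
      using continuous_attains_inf[of "cball x \<epsilon>" "\<lambda>y. dist (flow u y s) z"] \<epsilon>(1) by auto
    have "flow u y s = z"
    proof (rule ccontr)
      assume ne: "flow u y s \<noteq> z"
      show False
      proof (cases "dist x y < \<epsilon>")
        case True
        obtain q where "q \<in> (\<lambda>x. flow u x s) ` ball x \<epsilon>" "dist q z < dist (flow u y s) z"
          using open_contains_closer_point[OF flow_open_image[OF u s(1) open_ball] _ ne, of x \<epsilon>] True by auto
        then obtain y' where "y' \<in> ball x \<epsilon>" "dist (flow u y' s) z < dist (flow u y s) z"
          by blast
        then show False using min[of y'] by simp
      next
        case False
        then have eq: "norm (x - y) = \<epsilon>" using y by (simp add: dist_norm)
        \<comment> \<open>A minimiser on the boundary sphere has an image at distance at least
          \<open>\<epsilon> / C\<close> from that of \<open>x\<close>, yet both images are within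
          \<open>\<epsilon> / (2 * C)\<close> of \<open>z\<close>.\<close>
        have "\<epsilon> \<le> norm (flow u x s - flow u y s) * C"
          using est[OF u s R, of y] eq \<epsilon> by simp
        then have "\<epsilon> / C \<le> dist (flow u x s) (flow u y s)"
          using \<open>1 \<le> C\<close> by (simp add: dist_norm field_simps)
        also have "\<dots> \<le> dist (flow u x s) z + dist (flow u y s) z"
          by (rule dist_triangle2)
        also have "\<dots> \<le> dist (flow u x s) z + dist (flow u x s) z"
          using min[of x] \<epsilon> by simp
        also have "\<dots> < \<epsilon> / (2 * C) + \<epsilon> / (2 * C)"
          using z by simp
        also have "\<dots> = \<epsilon> / C" by simp
        finally show False by simp
      qed
    qed
    then show "\<exists>y\<in>cball x \<epsilon>. flow u y s = z" using y by blast
  qed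
qed

text \<open>The same slack in the initial point and in the time lets badness pass to limits of
  stopping points and remaining times.\<close>

definition bad :: "'a \<Rightarrow> real \<Rightarrow> bool" where
  "bad p T \<longleftrightarrow> (\<forall>\<epsilon>>0. \<forall>M. \<exists>x\<in>ball p \<epsilon>. \<exists>u\<in>inputs D. \<exists>t\<in>{0..T + \<epsilon>}. norm (flow u x t) > M)"

lemma bad_mono:
  assumes "bad p T" "T \<le> T'"
  shows "bad p T'"
proof -
  have "{0..T + \<epsilon>} \<subseteq> {0..T' + \<epsilon>}" for \<epsilon> using assms(2) by simp
  then show ?thesis using assms(1) unfolding bad_def by (meson subsetD)
qed

lemma bad_nonneg:
  assumes "bad p T"
  shows "0 \<le> T"
proof (rule ccontr)
  assume "\<not> 0 \<le> T"
  \<comment> \<open>Slack \<open>- T / 2\<close> leaves the time interval up to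
    \<open>T / 2 < 0\<close>, which is empty.\<close>
  then obtain t where "t \<in> {0..T + (- T / 2)}"
    using assms unfolding bad_def by (metis half_gt_zero neg_0_less_iff_less not_le minus_divide_left)
  then show False using \<open>\<not> 0 \<le> T\<close> by auto
qed

text \<open>Stop the escaping trajectories when they first hit a large sphere; a limit point of the stopping
  points is bad again, and it lies in the image of \<open>N\<close> because the flows cover balls of uniform size.\<close>

lemma bad_step:
  assumes bad: "bad p T" and N: "open N" "p \<in> N" and "\<eta> > 0"
  obtains u s q where "u \<in> inputs D" "0 \<le> s" "q \<in> N" "norm (flow u q s) > M"
    "bad (flow u q s) (T - s + \<eta>)"
proof -
  \<comment> \<open>Large enough to exceed \<open>M\<close> and to have all initial points within
    distance \<open>1\<close> of \<open>p\<close> inside the sphere.\<close>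
  define R where "R = max M (norm p + 1) + 1"
  have "\<exists>x u t. dist p x < inverse (real (Suc n)) \<and> u \<in> inputs D \<and> 0 \<le> t \<and>
      t \<le> T + inverse (real (Suc n)) \<and> norm (flow u x t) > R + n" for n
  proof -
    have "0 < inverse (real (Suc n))" by simp
    then have "\<exists>x\<in>ball p (inverse (real (Suc n))). \<exists>u\<in>inputs D. \<exists>t\<in>{0..T + inverse (real (Suc n))}.
        norm (flow u x t) > R + n"
      using bad unfolding bad_def by blast
    then show ?thesis unfolding Bex_def mem_ball atLeastAtMost_iff by blast
  qed
  then obtain x u t where x: "\<And>n. dist p (x n) < inverse (real (Suc n))"
    and u: "\<And>n. u n \<in> inputs D" and t: "\<And>n. 0 \<le> t n" "\<And>n. t n \<le> T + inverse (real (Suc n))"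
    and big: "\<And>n. norm (flow (u n) (x n) (t n)) > R + n"
    by metis
  have "\<exists>s. 0 \<le> s \<and> s \<le> t n \<and> norm (flow (u n) (x n) s) = R \<and>
      (\<forall>\<sigma>. 0 \<le> \<sigma> \<longrightarrow> \<sigma> \<le> s \<longrightarrow> norm (flow (u n) (x n) \<sigma>) \<le> R)" for n
  proof -
    have "inverse (real (Suc n)) \<le> 1" by (simp add: field_simps)
    then have "norm (x n) < norm p + 1"
      using x[of n] norm_triangle_sub[of "x n" p] by (simp add: dist_norm norm_minus_commute)
    then have "norm (flow (u n) (x n) 0) < R" by (simp add: flow_0 u R_def)
    moreover have "R \<le> norm (flow (u n) (x n) (t n))" using big[of n] by simp
    moreover have "continuous_on {0..t n} (\<lambda>s. norm (flow (u n) (x n) s))"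
      by (intro continuous_intros flow_continuous u)
    ultimately obtain s where s: "0 < s" "s \<le> t n" "norm (flow (u n) (x n) s) = R"
      "\<And>\<sigma>. 0 \<le> \<sigma> \<Longrightarrow> \<sigma> < s \<Longrightarrow> norm (flow (u n) (x n) \<sigma>) < R"
      using first_hitting_time[of 0 "t n" "\<lambda>s. norm (flow (u n) (x n) s)" R] t(1)[of n] by metis
    then show ?thesis by (intro exI[of _ s]) (auto simp: le_less)
  qed
  then obtain s where s: "\<And>n. 0 \<le> s n" "\<And>n. s n \<le> t n" "\<And>n. norm (flow (u n) (x n) (s n)) = R"
    and below: "\<And>n \<sigma>. 0 \<le> \<sigma> \<Longrightarrow> \<sigma> \<le> s n \<Longrightarrow> norm (flow (u n) (x n) \<sigma>) \<le> R"
    by metis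
  define z where "z n = flow (u n) (x n) (s n)" for n
  have sT: "s n \<le> T + 1" for n
  proof -
    have "inverse (real (Suc n)) \<le> 1" by (simp add: field_simps)
    then show ?thesis using s(2)[of n] t(2)[of n] by simp
  qed
  have "(z n, s n) \<in> sphere 0 R \<times> {0..T + 1}" for n
    using s sT by (simp add: z_def)
  moreover have "compact (sphere (0::'a) R \<times> {0..T + 1})"
    by (intro compact_Times) auto
  ultimately obtain l k where l: "l \<in> sphere (0::'a) R \<times> {0..T + 1}" and k: "strict_mono (k :: nat \<Rightarrow> nat)"
    and lim: "((\<lambda>n. (z n, s n)) \<circ> k) \<longlonglongrightarrow> l"
    unfolding compact_def by (metis (no_types, lifting))
  obtain z' s' where l_eq: "l = (z', s')" by (cases l)
  have zlim: "(\<lambda>n. z (k n)) \<longlonglongrightarrow> z'" and slim: "(\<lambda>n. s (k n)) \<longlonglongrightarrow> s'"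
    using tendsto_fst[OF lim] tendsto_snd[OF lim] by (auto simp: o_def l_eq)
  have "norm z' = R" using l by (simp add: l_eq)
  \<comment> \<open>Restarted at the stopping points, the trajectories still exceed
    \<open>R + k n\<close>, within remaining times bounded by quantities that tend to
    \<open>T - s'\<close>.\<close>
  have "bad z' (T - s')"
    unfolding bad_def
  proof (intro allI impI)
    fix \<epsilon> M' :: real assume "\<epsilon> > 0"
    have "\<forall>\<^sub>F n in sequentially. dist (z (k n)) z' < \<epsilon> \<and> dist (s (k n)) s' < \<epsilon>/2 \<and>
        inverse (real (Suc (k n))) < \<epsilon>/2 \<and> M' - R < real (k n)"
      using \<open>\<epsilon> > 0\<close> by (intro eventually_conj tendstoD zlim slim inverse_Suc_eventually_less
          real_subseq_eventually_greater k) auto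
    then obtain n where n: "dist (z (k n)) z' < \<epsilon>" "dist (s (k n)) s' < \<epsilon>/2"
      "inverse (real (Suc (k n))) < \<epsilon>/2" "M' - R < real (k n)"
      by (metis (mono_tags, lifting) eventually_happens trivial_limit_sequentially)
    show "\<exists>x\<in>ball z' \<epsilon>. \<exists>u\<in>inputs D. \<exists>t\<in>{0..T - s' + \<epsilon>}. norm (flow u x t) > M'"
    proof (intro bexI)
      show "norm (flow (\<lambda>\<tau>. u (k n) (s (k n) + \<tau>)) (z (k n)) (t (k n) - s (k n))) > M'"
        using flow_shift[OF u s(1), of "t (k n) - s (k n)" "k n" "k n" "x (k n)"] s(2)[of "k n"] big[of "k n"] n(4)
        by (simp add: z_def)
      show "t (k n) - s (k n) \<in> {0..T - s' + \<epsilon>}"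
        using s(2)[of "k n"] t(2)[of "k n"] n(2,3) by (simp add: dist_real_def abs_if split: if_splits)
      show "(\<lambda>\<tau>. u (k n) (s (k n) + \<tau>)) \<in> inputs D"
        by (rule inputs_shift[OF D_bounded u s(1)])
      show "z (k n) \<in> ball z' \<epsilon>" using n(1) by (simp add: dist_commute)
    qed
  qed
  \<comment> \<open>All stopped trajectories stay within \<open>R\<close> and end by
    \<open>T + 1\<close>, so \<open>C\<close> does not depend on \<open>n\<close>; eventually
    \<open>z'\<close> is close enough to be covered.\<close>
  obtain C where "1 \<le> C" and covers:
    "\<And>u s x \<epsilon> z. \<lbrakk>u \<in> inputs D; 0 \<le> s; s \<le> T + 1; \<And>t. 0 \<le> t \<Longrightarrow> t \<le> s \<Longrightarrow> norm (flow u x t) \<le> R;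
      0 < \<epsilon>; \<epsilon> * C < 1; dist (flow u x s) z < \<epsilon> / (2 * C)\<rbrakk> \<Longrightarrow> \<exists>y\<in>cball x \<epsilon>. flow u y s = z"
    using flow_covers_ball[of "T + 1" R] by blast
  obtain e where e: "e > 0" "ball p e \<subseteq> N" using N open_contains_ball by blast
  \<comment> \<open>The first bound leaves \<open>e/2\<close> for the distance from \<open>p\<close>
    to \<open>x (k n)\<close>, the second makes \<open>\<epsilon> * C\<close> at most
    \<open>1/2\<close>.\<close>
  define \<epsilon> where "\<epsilon> = min (e/2) (1 / (2 * C))"
  have "\<epsilon> > 0" using e \<open>1 \<le> C\<close> by (simp add: \<epsilon>_def)
  have "\<epsilon> * C \<le> 1 / (2 * C) * C"
    using \<open>1 \<le> C\<close> by (intro mult_right_mono) (auto simp: \<epsilon>_def)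
  then have "\<epsilon> * C < 1" using \<open>1 \<le> C\<close> by simp
  have "\<forall>\<^sub>F n in sequentially. dist (z (k n)) z' < \<epsilon> / (2 * C) \<and> dist (s (k n)) s' < \<eta> \<and>
      inverse (real (Suc (k n))) < e/2"
    using \<open>\<epsilon> > 0\<close> \<open>1 \<le> C\<close> \<open>\<eta> > 0\<close> e
    by (intro eventually_conj tendstoD zlim slim inverse_Suc_eventually_less k) auto
  then obtain n where n: "dist (z (k n)) z' < \<epsilon> / (2 * C)" "dist (s (k n)) s' < \<eta>"
    "inverse (real (Suc (k n))) < e/2"
    by (metis (mono_tags, lifting) eventually_happens trivial_limit_sequentially)
  have "\<exists>q\<in>cball (x (k n)) \<epsilon>. flow (u (k n)) q (s (k n)) = z'"
    by (rule covers[OF u s(1) sT below \<open>\<epsilon> > 0\<close> \<open>\<epsilon> * C < 1\<close>]) (use n(1) in \<open>simp_all add: z_def\<close>)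
  then obtain q where q: "q \<in> cball (x (k n)) \<epsilon>" "flow (u (k n)) q (s (k n)) = z'"
    by blast
  show ?thesis
  proof (rule that[OF u s(1)])
    have "dist p q \<le> dist p (x (k n)) + dist (x (k n)) q" by (rule dist_triangle)
    also have "\<dots> < e/2 + e/2"
      using x[of "k n"] n(3) q(1) by (intro add_less_le_mono) (auto simp: \<epsilon>_def)
    finally show "q \<in> N" using e(2) by auto
    show "norm (flow (u (k n)) q (s (k n))) > M" using q(2) \<open>norm z' = R\<close> by (simp add: R_def)
    \<comment> \<open>The stopping time is only within \<open>\<eta>\<close> of its limit
      \<open>s'\<close>; the allowance \<open>\<eta>\<close> pays for this.\<close>
    show "bad (flow (u (k n)) q (s (k n))) (T - s (k n) + \<eta>)"
      unfolding q(2) by (rule bad_mono[OF \<open>bad z' (T - s')\<close>])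
        (use n(2) in \<open>simp add: dist_real_def abs_if split: if_splits\<close>)
  qed
qed

text \<open>A Baire-type construction: stage \<open>n\<close> makes the trajectories of a whole ball
  of initial values reach norm \<open>n\<close>, under an input never changed later before the time
  reached.\<close>

lemma not_bad: "\<not> bad p T"
proof
  assume bad: "bad p T"
  obtain d0 where d0: "d0 \<in> D" using D_nonempty by blast
  \<comment> \<open>The remaining time at a new bad point is only known up to an error; errors \<open>(1/2)^Suc n\<close> keep the
    total time below \<open>T + 1\<close>.\<close>
  define P where "P k = (\<lambda>(x, e, v, t, T'). v \<in> inputs D \<and> 0 \<le> t \<and> 0 < e \<and> bad (flow v x t) T' \<and>
      t + T' \<le> T + 1 - (1/2)^k \<and> (\<forall>y\<in>cball x e. real k \<le> norm (flow v y t)))" for k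
  \<comment> \<open>The entries are centre and radius of the ball of initial values, input, elapsed
    time and remaining time.\<close>
  define Q where "Q = (\<lambda>(x :: 'a, e, v :: real \<Rightarrow> 'b, t, T' :: real) (x', e', v', t', T'' :: real).
      cball x' e' \<subseteq> cball x e \<and> t \<le> t' \<and> (\<forall>\<tau><t. v' \<tau> = v \<tau>))"
  have "\<exists>F. \<forall>n. P n (F n) \<and> Q (F n) (F (Suc n))"
  proof (rule dependent_nat_choice)
    \<comment> \<open>No time has elapsed, so the input is still arbitrary.\<close>
    have "P 0 (p, 1, \<lambda>_. d0, 0, T)"
      using bad by (simp add: P_def inputs_const[OF D_bounded d0] flow_0)
    then show "\<exists>F. P 0 F" by blast
  next
    fix F n assume "P n F"
    obtain x e v t T' where F: "F = (x, e, v, t, T')" by (cases F) auto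
    have v: "v \<in> inputs D" and t: "0 \<le> t" and e: "0 < e" and bad: "bad (flow v x t) T'"
      and time: "t + T' \<le> T + 1 - (1/2)^n"
      using \<open>P n F\<close> by (auto simp: P_def F)
    \<comment> \<open>Taking this image as the neighbourhood of the bad point lets the next one be
      traced back to an initial value in \<open>ball x e\<close>.\<close>
    have "open ((\<lambda>y. flow v y t) ` ball x e)" "flow v x t \<in> (\<lambda>y. flow v y t) ` ball x e"
      using flow_open_image[OF v t] e by auto
    then obtain u s q where u: "u \<in> inputs D" and s: "0 \<le> s" and q: "q \<in> (\<lambda>y. flow v y t) ` ball x e"
      and big: "norm (flow u q s) > real (Suc n)" and bad': "bad (flow u q s) (T' - s + (1/2)^Suc n)"
      by (rule bad_step[OF bad, of _ "(1/2)^Suc n" "real (Suc n)"]) auto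
    obtain x' where x': "x' \<in> ball x e" "q = flow v x' t" using q by blast
    define v' where "v' = concat_at t v u"
    have v': "v' \<in> inputs D" unfolding v'_def by (rule inputs_concat[OF D_bounded v u])
    have flow': "flow v' y (t + s) = flow u (flow v y t) s" for y
      unfolding v'_def by (rule flow_concat[OF v u t s])
    \<comment> \<open>The strict norm bound at \<open>x'\<close> persists nearby by continuity in
      the initial value.\<close>
    have "open (ball x e \<inter> (\<lambda>y. flow v' y (t + s)) -` {w. real (Suc n) < norm w})"
      using flow_continuous_initial[OF v', of "t + s"] s t
      by (intro continuous_open_preimage open_Collect_less continuous_intros) auto
    moreover have "x' \<in> ball x e \<inter> (\<lambda>y. flow v' y (t + s)) -` {w. real (Suc n) < norm w}"
      using x' big by (simp add: flow')
    ultimately obtain e' where e': "0 < e'"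
      "cball x' e' \<subseteq> ball x e \<inter> (\<lambda>y. flow v' y (t + s)) -` {w. real (Suc n) < norm w}"
      using open_contains_cball by blast
    have "real (Suc n) \<le> norm (flow v' y (t + s))" if "y \<in> cball x' e'" for y
      using subsetD[OF e'(2) that] by simp
    moreover have "bad (flow v' x' (t + s)) (T' - s + (1/2)^Suc n)"
      using bad' by (simp only: flow' x'(2))
    moreover have "(t + s) + (T' - s + (1/2)^Suc n) \<le> T + 1 - (1/2)^Suc n"
      using time by simp
    ultimately have "P (Suc n) (x', e', v', t + s, T' - s + (1/2)^Suc n)"
      using v' t s e'(1) unfolding P_def prod.case by (intro conjI ballI add_nonneg_nonneg)
    moreover have "cball x' e' \<subseteq> cball x e"
      using e'(2) ball_subset_cball by blast
    then have "Q F (x', e', v', t + s, T' - s + (1/2)^Suc n)"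
      using s by (simp add: Q_def F v'_def concat_at_def)
    ultimately show "\<exists>F'. P (Suc n) F' \<and> Q F F'" by blast
  qed
  then obtain F where F: "\<And>n. P n (F n)" "\<And>n. Q (F n) (F (Suc n))" by blast
  obtain x e v t T' where F_eq: "\<And>n. F n = (x n, e n, v n, t n, T' n)"
    by (rule that[of "fst \<circ> F" "fst \<circ> snd \<circ> F" "fst \<circ> snd \<circ> snd \<circ> F"
          "fst \<circ> snd \<circ> snd \<circ> snd \<circ> F" "snd \<circ> snd \<circ> snd \<circ> snd \<circ> F"]) simp
  have v: "\<And>n. v n \<in> inputs D" and t: "\<And>n. 0 \<le> t n" and e: "\<And>n. 0 < e n"
    and bad_n: "\<And>n. bad (flow (v n) (x n) (t n)) (T' n)"
    and time: "\<And>n. t n + T' n \<le> T + 1 - (1/2)^n"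
    and large: "\<And>n y. y \<in> cball (x n) (e n) \<Longrightarrow> real n \<le> norm (flow (v n) y (t n))"
    using F(1) by (auto simp: P_def F_eq)
  have nest: "\<And>n. cball (x (Suc n)) (e (Suc n)) \<subseteq> cball (x n) (e n)" and tmono: "\<And>n. t n \<le> t (Suc n)"
    and ext: "\<And>n \<tau>. \<tau> < t n \<Longrightarrow> v (Suc n) \<tau> = v n \<tau>"
    using F(2) by (auto simp: Q_def F_eq)
  obtain w where w: "w \<in> inputs D" "\<And>n \<tau>. \<tau> < t n \<Longrightarrow> w \<tau> = v n \<tau>"
    using limit_of_consistent_inputs[of D v t, OF D_bounded D_nonempty v tmono ext] by blast
  have "\<Inter>(range (\<lambda>n. cball (x n) (e n))) \<noteq> {}"
  proof (rule compact_nest)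
    show "cball (x n) (e n) \<subseteq> cball (x m) (e m)" if "m \<le> n" for m n
      by (rule lift_Suc_antimono_le[of "\<lambda>n. cball (x n) (e n)", OF nest that])
    show "cball (x n) (e n) \<noteq> {}" for n using e[of n] by simp
  qed simp
  then obtain y where y: "\<And>n. y \<in> cball (x n) (e n)" by blast
  obtain B where B: "\<And>\<tau>. 0 \<le> \<tau> \<Longrightarrow> \<tau> \<le> T + 1 \<Longrightarrow> norm (flow w y \<tau>) \<le> B"
    using flow_bounded[OF w(1)] by blast
  have "real n \<le> B" for n
  proof -
    have "real n \<le> norm (flow (v n) y (t n))" by (rule large[OF y])
    \<comment> \<open>Agreement of the inputs before \<open>t n\<close> determines the state at
      \<open>t n\<close>.\<close>
    also have "flow (v n) y (t n) = flow w y (t n)"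
      by (rule flow_cong[OF v w(1) t w(2), symmetric])
    also have "norm (flow w y (t n)) \<le> B"
    proof (rule B[OF t])
      \<comment> \<open>The remaining time of a bad point is nonnegative, so the elapsed time alone
        is below \<open>T + 1\<close>.\<close>
      have "(0::real) < (1/2)^n" by simp
      then show "t n \<le> T + 1" using time[of n] bad_nonneg[OF bad_n, of n] by linarith
    qed
    finally show ?thesis .
  qed
  then show False by (meson reals_Archimedean2 not_le)
qed

text \<open>Otherwise initial values of ever larger trajectories accumulate, by compactness, at a
  bad point.\<close>

lemma reachable_set_bounded:
  obtains M where "\<And>x u t. norm x \<le> R \<Longrightarrow> u \<in> inputs D \<Longrightarrow> 0 \<le> t \<Longrightarrow> t \<le> T \<Longrightarrow> norm (flow u x t) \<le> M"
proof (rule ccontr)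
  assume *: "\<not> thesis"
  have "\<exists>x u t. norm x \<le> R \<and> u \<in> inputs D \<and> 0 \<le> t \<and> t \<le> T \<and> norm (flow u x t) > real n" for n :: nat
    using * that[of "real n"] by (meson not_le)
  then obtain x u t where x: "\<And>n :: nat. norm (x n) \<le> R" and u: "\<And>n. u n \<in> inputs D"
    and t: "\<And>n. 0 \<le> t n" "\<And>n. t n \<le> T" and big: "\<And>n::nat. norm (flow (u n) (x n) (t n)) > n"
    by metis
  have "x n \<in> cball 0 R" for n using x by simp
  then obtain p k where k: "strict_mono (k :: nat \<Rightarrow> nat)" and lim: "(x \<circ> k) \<longlonglongrightarrow> p"
    using compact_cball[of "0::'a" R] unfolding compact_def by metis
  have "bad p T"
    unfolding bad_def
  proof (intro allI impI)
    fix \<epsilon> M :: real assume "\<epsilon> > 0"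
    have "\<forall>\<^sub>F n in sequentially. dist (x (k n)) p < \<epsilon> \<and> M < real (k n)"
      using \<open>\<epsilon> > 0\<close> by (intro eventually_conj tendstoD lim[unfolded o_def] real_subseq_eventually_greater k)
    then obtain n where n: "dist (x (k n)) p < \<epsilon>" "M < real (k n)"
      by (metis (mono_tags, lifting) eventually_happens trivial_limit_sequentially)
    show "\<exists>x\<in>ball p \<epsilon>. \<exists>u\<in>inputs D. \<exists>t\<in>{0..T + \<epsilon>}. norm (flow u x t) > M"
      using n big[of "k n"] u[of "k n"] t[of "k n"] \<open>\<epsilon> > 0\<close>
      by (intro bexI[of _ "x (k n)"] bexI[of _ "u (k n)"] bexI[of _ "t (k n)"]) (auto simp: dist_commute)
  qed
  then show False using not_bad by blast
qed

text \<open>After the attraction time for accuracy \<open>1\<close> the output is at most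
  \<open>1\<close>; before it the state stays in a ball on which \<open>h\<close> is
  bounded.\<close>

lemma Lagrange_output_stable:
  fixes h :: "'a \<Rightarrow> 'c::euclidean_space"
  assumes attr: "URGOA D f h" and h: "continuous_on UNIV h"
  shows "robustly_Lagrange_output_stable D f h"
  unfolding robustly_Lagrange_output_stable_def
proof (intro allI impI)
  fix R :: real assume "R > 0"
  obtain T where T: "\<And>d x0 \<phi> t. d \<in> inputs D \<Longrightarrow> norm x0 \<le> R \<Longrightarrow> solution f x0 d \<phi> \<Longrightarrow> T \<le> t \<Longrightarrow>
      norm (h (\<phi> t)) \<le> 1"
    using attr \<open>R > 0\<close> unfolding URGOA_def by (metis zero_less_one)
  obtain M where M: "\<And>x u t. norm x \<le> R \<Longrightarrow> u \<in> inputs D \<Longrightarrow> 0 \<le> t \<Longrightarrow> t \<le> T \<Longrightarrow> norm (flow u x t) \<le> M"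
    using reachable_set_bounded[of R T] by blast
  have "compact (h ` cball 0 M)"
    by (rule compact_continuous_image[OF continuous_on_subset[OF h]]) auto
  then obtain B where B: "\<forall>y\<in>h ` cball 0 M. norm y \<le> B"
    using compact_imp_bounded bounded_iff by blast
  have "norm (h (\<phi> t)) \<le> max 1 B"
    if "d \<in> inputs D" "norm x0 \<le> R" "solution f x0 d \<phi>" "0 \<le> t" for d x0 \<phi> t
  proof (cases "T \<le> t")
    case True
    then show ?thesis using T[OF that(1-3)] by (simp add: le_max_iff_disj)
  next
    case False
    then have "norm (\<phi> t) \<le> M"
      using M[OF that(2,1,4)] flow_unique[OF that(1,3,4)] by simp
    then show ?thesis using B by (simp add: le_max_iff_disj)
  qed
  moreover have "0 < max 1 B" by simp
  ultimately show "\<exists>\<epsilon>>0. \<forall>d\<in>inputs D. \<forall>x0 \<phi>. norm x0 \<le> R \<and> solution f x0 d \<phi> \<longrightarrow> (\<forall>t\<ge>0. norm (h (\<phi> t)) \<le> \<epsilon>)"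
    by blast
qed

end

theorem theorem1:
  fixes D :: "(real ^ 'm) set"
    and f :: "real ^ 'n \<Rightarrow> real ^ 'm \<Rightarrow> real ^ 'n"
    and h :: "real ^ 'n \<Rightarrow> real ^ 'k"
    and V W :: "real ^ 'n \<Rightarrow> real"
    and gV gW :: "real ^ 'n \<Rightarrow> real ^ 'n"
    and \<rho> a :: "real \<Rightarrow> real"
    and r :: real
  assumes D_nonempty: "D \<noteq> {}"
    and f_cont: "continuous_on (UNIV \<times> D) (\<lambda>(x, d). f x d)"
    and f_lipschitz: "\<And>S K. compact S \<Longrightarrow> bounded K \<Longrightarrow> K \<subseteq> D \<Longrightarrow>
          \<exists>L>0. \<forall>x\<in>S. \<forall>z\<in>S. \<forall>d\<in>K. norm (f x d - f z d) \<le> L * norm (x - z)"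
    and f_zero: "\<And>d. d \<in> D \<Longrightarrow> f 0 d = 0"
    and h_cont: "continuous_on UNIV h"
    and h_zero: "h 0 = 0"
    and complete: "forward_complete D f"
    and V_C1: "C1_with_gradient V gV" and V_nonneg: "\<And>x. V x \<ge> 0"
    and W_C1: "C1_with_gradient W gW" and W_nonneg: "\<And>x. W x \<ge> 0"
    and rho: "continuous_on {0..} \<rho>" "pos_def \<rho>"
    and V_decay: "\<And>x d. d \<in> D \<Longrightarrow> gV x \<bullet> f x d \<le> - \<rho> (W x)"
    and r_pos: "r > 0"
    and a_K: "a \<in> class_K"
    and W_lower: "\<And>x. W x < r \<Longrightarrow> a (norm (h x)) \<le> W x"
    and W_decay: "\<And>x d. W x < r \<Longrightarrow> d \<in> D \<Longrightarrow> gW x \<bullet> f x d \<le> 0"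
    and alternatives:
      "Liminf at_top (\<lambda>s. ereal (\<rho> s)) > 0 \<or>
       (\<exists>\<zeta> Q gQ. \<zeta> \<in> class_K_inf \<and> C1_with_gradient Q gQ \<and> (\<forall>x. Q x \<ge> 0) \<and>
          (\<forall>x. W x \<le> \<zeta> (Q x)) \<and> (\<forall>x. \<forall>d\<in>D. gQ x \<bullet> f x d \<le> 0))"
  shows "URGOA D f h \<and> robustly_Lyapunov_output_stable D f h \<and>
    (compact D \<and>
     (\<forall>S. compact S \<longrightarrow> (\<exists>L>0. \<forall>x\<in>S. \<forall>z\<in>S. \<forall>d\<in>D. \<forall>e\<in>D.
        norm (f x d - f z e) \<le> L * (norm (x - z) + norm (d - e))))
     \<longrightarrow> URGAOS D f h)"
proof -
  note stable = output_attractive_and_Lyapunov_stable[OF D_nonempty f_zero V_C1 V_nonneg W_C1 W_nonneg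
      rho V_decay r_pos a_K W_lower W_decay alternatives]
  have "URGAOS D f h" if "compact D"
  proof -
    \<comment> \<open>Compactness makes \<open>K = D\<close> admissible in
      \<open>f_lipschitz\<close>.\<close>
    interpret bounded_input_system D f
      using f_lipschitz[OF _ compact_imp_bounded[OF that] order_refl] D_nonempty complete
        compact_imp_bounded[OF that]
      by unfold_locales
    show ?thesis
      using stable Lagrange_output_stable[OF stable(1) h_cont] by (simp add: URGAOS_def)
  qed
  then show ?thesis using stable by blast
qed

end
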